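(* Let $X=\{\mathbf{x}_j: j\in\mathbb{N}\}\subset\mathbb{R}^n$ be a set of distinct points with $\delta(X)=\inf_{j\neq k}|\mathbf{x}_j-\mathbf{x}_k|>0$ and such that the linear span of $X$ has dimension $d$, $1\le d\le n$. Let $\alpha>0$ and let $\mathcal{M}_\alpha(z)=\frac{2^{1-\alpha}}{\Gamma(\alpha)}K_\alpha(z)z^\alpha$ for $z>0$, $\mathcal{M}_\alpha(0)=1$. Consider the Schoenberg matrix $\mathbf{S}_X(\mathcal{M}_\alpha)=\big[\mathcal{M}_\alpha(|\mathbf{x}_j-\mathbf{x}_k|)\big]_{j,k\in\mathbb{N}}$. (i) $\mathbf{S}_X(\mathcal{M}_\alpha)$ defines a bounded self-adjoint operator on $\ell^2(\mathbb{N})$ with $$\|\mathbf{S}_X(\mathcal{M}_\alpha)\|\le 1 + \frac{d\, 2^{d-1} (5^d -1)\, \Gamma\left(\alpha + \frac d2\right)\Gamma\left(\frac d2\right)}{\left[\delta(X)\right]^d\,\Gamma(\alpha)}.$$ (ii) If $n\ge 2$, $\mathbf{S}_X(\mathcal{M}_\alpha)$ defines a bounded invertible operator on $\ell^2(\mathbb{N})$. If $n=d=1$ and $\delta(X) > \frac{4\,\Gamma(\alpha + \frac 12)\Gamma(\frac 12)}{\Gamma(\alpha)}$, then $\mathbf{S}_X(\mathcal{M}_\alpha)$ defines a bounded invertible operator on $\ell^2(\mathbb{N})$.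
   Context: $K_\alpha$ is the modified Bessel function of the second kind of order $\alpha$. The matrix acts on $\ell^2(\mathbb{N})$ by matrix multiplication. *)

theory Defs
  imports "HOL-Analysis.Analysis"
begin

text \<open>Modified Bessel function of the second kind, via the standard integral
  representation  K_a(z) = int_0^infinity exp(-z cosh t) cosh(a t) dt  (z > 0).\<close>
definition besselK :: "real \<Rightarrow> real \<Rightarrow> real" where
  "besselK a z = integral {0..} (\<lambda>t. exp (- z * cosh t) * cosh (a * t))"

definition matern :: "real \<Rightarrow> real \<Rightarrow> real" where
  "matern a z = (if z = 0 then 1
     else 2 powr (1 - a) / Gamma a * besselK a z * z powr a)"

definition schoenberg_matrix :: "(nat \<Rightarrow> 'a::metric_space) \<Rightarrow> (real \<Rightarrow> real) \<Rightarrow> nat \<Rightarrow> nat \<Rightarrow> real" where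
  "schoenberg_matrix x f j k = f (dist (x j) (x k))"

definition separation :: "(nat \<Rightarrow> 'a::metric_space) \<Rightarrow> real" where
  "separation x = Inf {dist (x j) (x k) | j k. j \<noteq> k}"

definition l2 :: "(nat \<Rightarrow> complex) set" where
  "l2 = {v. summable (\<lambda>k. (cmod (v k))\<^sup>2)}"

definition l2norm :: "(nat \<Rightarrow> complex) \<Rightarrow> real" where
  "l2norm v = sqrt (\<Sum>k. (cmod (v k))\<^sup>2)"

definition l2inner :: "(nat \<Rightarrow> complex) \<Rightarrow> (nat \<Rightarrow> complex) \<Rightarrow> complex" where
  "l2inner u v = (\<Sum>k. u k * cnj (v k))"

definition mat_apply :: "(nat \<Rightarrow> nat \<Rightarrow> real) \<Rightarrow> (nat \<Rightarrow> complex) \<Rightarrow> nat \<Rightarrow> complex" where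
  "mat_apply A v = (\<lambda>j. \<Sum>k. complex_of_real (A j k) * v k)"

definition bounded_matrix_op :: "(nat \<Rightarrow> nat \<Rightarrow> real) \<Rightarrow> real \<Rightarrow> bool" where
  "bounded_matrix_op A C \<longleftrightarrow>
     (\<forall>v\<in>l2. (\<forall>j. summable (\<lambda>k. complex_of_real (A j k) * v k))
              \<and> mat_apply A v \<in> l2
              \<and> l2norm (mat_apply A v) \<le> C * l2norm v)"

definition defines_bounded_op :: "(nat \<Rightarrow> nat \<Rightarrow> real) \<Rightarrow> bool" where
  "defines_bounded_op A \<longleftrightarrow> (\<exists>C. bounded_matrix_op A C)"

definition defines_selfadjoint_op :: "(nat \<Rightarrow> nat \<Rightarrow> real) \<Rightarrow> bool" where
  "defines_selfadjoint_op A \<longleftrightarrow> defines_bounded_op A \<and>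
     (\<forall>u\<in>l2. \<forall>v\<in>l2. l2inner (mat_apply A u) v = l2inner u (mat_apply A v))"

definition defines_invertible_op :: "(nat \<Rightarrow> nat \<Rightarrow> real) \<Rightarrow> bool" where
  "defines_invertible_op A \<longleftrightarrow> defines_bounded_op A \<and>
     bij_betw (mat_apply A) l2 l2 \<and>
     (\<exists>C. \<forall>v\<in>l2. l2norm v \<le> C * l2norm (mat_apply A v))"

end

theory Submission
  imports Defs
begin

text \<open>The Matern function is a mixture of Gaussians,
  \<open>\<Gamma>(\<alpha>) M\<^sub>\<alpha>(z) = \<integral> s\<^bsup>\<alpha>-1\<^esup> e\<^bsup>-s\<^esup> e\<^bsup>-z\<^sup>2/(4s)\<^esup> ds\<close> over \<open>s > 0\<close>.
  A packing argument in the \<open>d\<close>-dimensional span of the points bounds the off-diagonal row sums of the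
  Gaussian matrix at scale \<open>s\<close> by a multiple of \<open>s\<^bsup>d/2\<^esup>\<close>; integrating over \<open>s\<close> bounds the row sums of
  the Schoenberg matrix, and Schur's test bounds its norm. Every Gaussian matrix is positive
  semidefinite, and for small \<open>s\<close> it is diagonally dominant, so the mixture is coercive on \<open>\<ell>\<^sup>2\<close> and
  hence invertible.\<close>

subsection \<open>The Matern function as a mixture of Gaussians\<close>

text \<open>Strict positive definiteness of every finite section would not yield invertibility on
  \<open>l2\<close>, since the lower bounds could tend to 0 as the sections grow. The bound has to
  be uniform in the section. It comes from one fixed interval of scales s, so the row sum estimate
  serves both the norm bound and the inversion. Origin of the constant: packing gives at most 3^d
  (r/\<delta>)^d points within distance r of a given one, and 3^d is relaxed to 5^d - 1. A Gaussian
  exponent is at most u exactly when the distance is at most r = 2 sqrt(s u), whence the factor 2^d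
  s^(d/2) u^(d/2). Integrating u^(d/2) against e^(-u) gives Gamma(d/2 + 1), and integrating s^(d/2)
  against the normalised Gamma kernel gives Gamma(\<alpha> + d/2) / Gamma(\<alpha>).\<close>

lemma Gamma_kernel_absolutely_integrable:
  assumes "a > (0::real)"
  shows "(\<lambda>s. s powr (a - 1) / exp s) absolutely_integrable_on {0<..}"
    "((\<lambda>s. s powr (a - 1) / exp s) has_integral Gamma a) {0<..}"
proof -
  \<comment> \<open>Dropping the null set {0} makes the domain the image of the real line under s =
    (z/2) e^t, the substitution used for the Bessel integral.\<close>
  have "negligible {x \<in> {0::real..} - {0<..}. x powr (a - 1) / exp x \<noteq> 0}"
    by (rule negligible_subset[of "{0}"]) auto
  moreover have "{x \<in> {0<..} - {0::real..}. x powr (a - 1) / exp x \<noteq> 0} = {}" by auto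
  ultimately show "((\<lambda>s. s powr (a - 1) / exp s) has_integral Gamma a) {0<..}"
    using has_integral_spike_set_eq[of "{0::real..}" "{0<..}" "\<lambda>s. s powr (a - 1) / exp s"]
      Gamma_integral_real[OF assms] by (simp only: negligible_empty simp_thms)
  then show "(\<lambda>s. s powr (a - 1) / exp s) absolutely_integrable_on {0<..}"
    by (intro nonnegative_absolutely_integrable_1) auto
qed

lemma Gamma_kernel_times_bounded:
  fixes h :: "real \<Rightarrow> real"
  assumes "a > 0" "continuous_on {0<..} h" "bounded (h ` {0<..})"
  shows "(\<lambda>s. s powr (a - 1) / exp s * h s) absolutely_integrable_on {0<..}"
proof -
  have "h \<in> borel_measurable (lebesgue_on {0<..})"
    by (rule continuous_imp_measurable_on_sets_lebesgue[OF assms(2)]) simp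
  from absolutely_integrable_bounded_measurable_product_real[OF this _ assms(3)
      Gamma_kernel_absolutely_integrable(1)[OF assms(1)]]
  have "(\<lambda>s. h s * (s powr (a - 1) / exp s)) absolutely_integrable_on {0<..}" by simp
  then show ?thesis by (simp only: mult.commute[of "h _"])
qed

text \<open>The substitution s = (z/2) e^t leads to exp(-z cosh t) exp(a t) on the whole line, while
  \<open>besselK\<close> integrates over a half-line. Folding at 0 replaces exp(a t) by 2 cosh(a
  t).\<close>

lemma integral_UNIV_fold:
  fixes k :: "real \<Rightarrow> real"
  assumes k: "k absolutely_integrable_on UNIV"
  shows "integral UNIV k = integral {0..} (\<lambda>t. k t + k (- t))"
proof -
  have sub: "k absolutely_integrable_on A" if "A \<in> sets lebesgue" for A
    using set_integrable_subset[OF k] that by auto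
  have im: "uminus ` {0::real..} = {..0}" by auto
  have "(\<lambda>t. \<bar>-1\<bar> * k (- t)) absolutely_integrable_on {0..} \<and>
      integral {0..} (\<lambda>t. \<bar>-1\<bar> * k (- t)) = integral {..0} k"
    by (subst has_absolute_integral_change_of_variables_1'[where g=uminus and g'="\<lambda>_. -1"])
      (auto intro!: derivative_eq_intros sub inj_onI simp: im)
  then have r: "(\<lambda>t. k (- t)) integrable_on {0..}" "integral {0..} (\<lambda>t. k (- t)) = integral {..0} k"
    by (auto dest: set_lebesgue_integral_eq_integral(1))
  have i: "k integrable_on {0..}" "k integrable_on {..0}"
    using sub[of "{0..}"] sub[of "{..0}"] by (auto dest: set_lebesgue_integral_eq_integral(1))
  have "integral UNIV k = integral ({..0} \<union> {0..}) k"
    by (rule arg_cong[where f="\<lambda>A. integral A k"]) auto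
  also have "\<dots> = integral {..0} k + integral {0..} k"
    by (rule Henstock_Kurzweil_Integration.integral_Un[OF i(2,1)]) (auto intro: negligible_subset[of "{0}"])
  finally show ?thesis
    using r i by (subst integral_add) auto
qed

text \<open>The substitution \<open>s = (z / 2) e\<^sup>t\<close> turns \<open>s + z\<^sup>2 / (4 s)\<close> into \<open>z cosh t\<close>.\<close>
lemma matern_has_integral:
  assumes a: "a > 0" and z: "z \<ge> 0"
  shows "((\<lambda>s. s powr (a - 1) / exp s * exp (- z\<^sup>2 / (4 * s))) has_integral matern a z * Gamma a) {0<..}"
\<comment> \<open>At z = 0 the integral defining K_a diverges, but the Gaussian factor is 1 and the
  mixture is the Gamma integral itself. This agrees with the value 1 prescribed in
  \<open>matern\<close>.\<close>
proof (cases "z = 0")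
  case True
  then show ?thesis using Gamma_kernel_absolutely_integrable(2)[OF a] by (simp add: matern_def)
next
  case False
  with z have z: "z > 0" by simp
  define f where "f s = s powr (a - 1) / exp s * exp (- z\<^sup>2 / (4 * s))" for s
  define k where "k t = exp (- z * cosh t) * exp (a * t)" for t
  have f: "f absolutely_integrable_on {0<..}"
    unfolding f_def
    by (intro Gamma_kernel_times_bounded a boundedI[of _ 1] continuous_intros) auto
  have im: "(\<lambda>t. z / 2 * exp t) ` UNIV = {0<..}"
  proof (intro equalityI subsetI)
    fix s :: real assume "s \<in> {0<..}"
    then have "s = z / 2 * exp (ln (2 * s / z))" using z by simp
    then show "s \<in> (\<lambda>t. z / 2 * exp t) ` UNIV" by blast
  qed (use z in auto)
  \<comment> \<open>The Jacobian of t -> w = (z/2) e^t is w itself. It raises w^(a-1) to w^a =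
    (z/2)^a e^(a t), which is where the factor z^a of the Matern function originates.\<close>
  have eq: "\<bar>z / 2 * exp t\<bar> * f (z / 2 * exp t) = (z / 2) powr a * k t" for t
  proof -
    define w where "w = z / 2 * exp t"
    have w: "w > 0" using z by (simp add: w_def)
    have "w powr 1 * w powr (a - 1) = w powr a"
      by (subst powr_add[symmetric]) simp
    moreover have "w powr a = (z / 2) powr a * exp (t * a)"
      unfolding w_def by (simp only: powr_mult exp_powr_real)
    moreover have "z\<^sup>2 / (4 * w) = z / 2 * exp (- t)"
      using z by (simp add: w_def exp_minus field_simps power2_eq_square)
    then have "w + z\<^sup>2 / (4 * w) = z * cosh t"
      by (simp add: w_def cosh_def algebra_simps)
    then have "exp (- z\<^sup>2 / (4 * w)) = exp (- z * cosh t) * exp w"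
      by (simp flip: exp_add)
    ultimately show ?thesis
      using w unfolding w_def[symmetric] f_def k_def by (simp add: mult.commute[of t])
  qed
  have "(\<lambda>t. \<bar>z / 2 * exp t\<bar> * f (z / 2 * exp t)) absolutely_integrable_on UNIV \<and>
      integral UNIV (\<lambda>t. \<bar>z / 2 * exp t\<bar> * f (z / 2 * exp t)) = integral {0<..} f"
    by (subst has_absolute_integral_change_of_variables_1'[where g="\<lambda>t. z / 2 * exp t" and g'="\<lambda>t. z / 2 * exp t"])
      (use z f im in \<open>auto intro!: derivative_eq_intros inj_onI\<close>)
  then have kk: "(\<lambda>t. (z / 2) powr a * k t) absolutely_integrable_on UNIV"
    "integral {0<..} f = (z / 2) powr a * integral UNIV k"
    unfolding eq by auto
  have "k absolutely_integrable_on UNIV"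
    using absolutely_integrable_scaleR_left[OF kk(1), of "1 / (z / 2) powr a"] z by simp
  moreover have kk2: "k t + k (- t) = 2 * (exp (- z * cosh t) * cosh (a * t))" for t
    by (simp add: k_def cosh_field_def[of "a * t"] distrib_left add.commute)
  ultimately have "integral UNIV k = integral {0..} (\<lambda>t. 2 * (exp (- z * cosh t) * cosh (a * t)))"
    by (subst integral_UNIV_fold) (simp_all add: kk2)
  also have "\<dots> = 2 * besselK a z" by (simp add: besselK_def)
  finally have "integral {0<..} f = (z / 2) powr a * (2 * besselK a z)" using kk(2) by simp
  also have "\<dots> = matern a z * Gamma a"
    using z less_imp_neq[OF Gamma_real_pos[OF a]] by (simp add: matern_def powr_divide powr_diff)
  finally show ?thesis
    using integrable_integral[OF set_lebesgue_integral_eq_integral(1)[OF f]] by (simp only: f_def[abs_def])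
qed

subsection \<open>Bounded matrix operators on square-summable sequences\<close>

lemma sum_le_l2norm:
  assumes "v \<in> l2" "finite F"
  shows "(\<Sum>k\<in>F. (cmod (v k))\<^sup>2) \<le> (l2norm v)\<^sup>2"
proof -
  have s: "summable (\<lambda>k. (cmod (v k))\<^sup>2)" using assms by (simp add: l2_def)
  have "(\<Sum>k\<in>F. (cmod (v k))\<^sup>2) \<le> (\<Sum>k. (cmod (v k))\<^sup>2)"
    using s assms by (intro sum_le_suminf) auto
  moreover have "0 \<le> (\<Sum>k. (cmod (v k))\<^sup>2)" using s by (intro suminf_nonneg) auto
  ultimately show ?thesis by (simp add: l2norm_def)
qed

lemma l2norm_nonneg: "v \<in> l2 \<Longrightarrow> 0 \<le> l2norm v"
  by (auto simp: l2norm_def l2_def intro!: suminf_nonneg)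

lemma l2I_norm_le:
  assumes "B \<ge> 0" and "\<And>N. (\<Sum>k<N. (cmod (v k))\<^sup>2) \<le> B\<^sup>2"
  shows "v \<in> l2" "l2norm v \<le> B"
proof -
  have s: "summable (\<lambda>k. (cmod (v k))\<^sup>2)"
    by (rule summableI_nonneg_bounded[where x="B\<^sup>2"]) (use assms in auto)
  then show "v \<in> l2" by (simp add: l2_def)
  have "(\<Sum>k. (cmod (v k))\<^sup>2) \<le> B\<^sup>2"
    by (rule suminf_le_const[OF s]) (use assms in auto)
  then show "l2norm v \<le> B" unfolding l2norm_def using assms(1) real_le_lsqrt by metis
qed

lemma cmod_le_l2norm: "v \<in> l2 \<Longrightarrow> cmod (v k) \<le> l2norm v"
  using sum_le_l2norm[of v "{k}"] l2norm_nonneg[of v] by (simp add: power2_le_iff_abs_le)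

lemma l2_sum:
  assumes "u \<in> l2" "v \<in> l2"
  shows "(\<lambda>k. u k + v k) \<in> l2" "l2norm (\<lambda>k. u k + v k) \<le> l2norm u + l2norm v"
proof -
  have "(\<Sum>k<N. (cmod (u k + v k))\<^sup>2) \<le> (l2norm u + l2norm v)\<^sup>2" for N
  proof -
    have "L2_set (\<lambda>k. cmod (u k + v k)) {..<N} \<le> L2_set (\<lambda>k. cmod (u k) + cmod (v k)) {..<N}"
      by (intro L2_set_mono) (auto intro: norm_triangle_ineq)
    also have "\<dots> \<le> L2_set (\<lambda>k. cmod (u k)) {..<N} + L2_set (\<lambda>k. cmod (v k)) {..<N}"
      by (rule L2_set_triangle_ineq)
    also have "\<dots> \<le> l2norm u + l2norm v"
      using sum_le_l2norm[of u "{..<N}"] sum_le_l2norm[of v "{..<N}"] l2norm_nonneg assms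
      unfolding L2_set_def by (intro add_mono) (auto intro!: real_le_lsqrt sum_nonneg)
    finally have "sqrt (\<Sum>k<N. (cmod (u k + v k))\<^sup>2) \<le> l2norm u + l2norm v"
      by (simp add: L2_set_def)
    then show ?thesis by (simp add: sqrt_le_D)
  qed
  with l2norm_nonneg assms
  show "(\<lambda>k. u k + v k) \<in> l2" "l2norm (\<lambda>k. u k + v k) \<le> l2norm u + l2norm v"
    using l2I_norm_le[of "l2norm u + l2norm v" "\<lambda>k. u k + v k"] by auto
qed

lemma l2_scale:
  assumes "v \<in> l2"
  shows "(\<lambda>k. c * v k) \<in> l2" "l2norm (\<lambda>k. c * v k) = cmod c * l2norm v"
proof -
  have s: "summable (\<lambda>k. (cmod (v k))\<^sup>2)" using assms by (simp add: l2_def)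
  show "(\<lambda>k. c * v k) \<in> l2"
    using s by (simp add: l2_def norm_mult power_mult_distrib summable_mult)
  show "l2norm (\<lambda>k. c * v k) = cmod c * l2norm v"
    using s by (simp add: l2norm_def norm_mult power_mult_distrib suminf_mult real_sqrt_mult)
qed

lemma l2_diff:
  assumes "u \<in> l2" "v \<in> l2"
  shows "(\<lambda>k. u k - v k) \<in> l2"
  using l2_sum(1)[OF assms(1) l2_scale(1)[OF assms(2), of "-1"]] by simp

lemma l2norm_eq_0: "v \<in> l2 \<Longrightarrow> l2norm v = 0 \<Longrightarrow> v k = 0"
  using cmod_le_l2norm[of v k] by simp

text \<open>A Fatou argument: every finite partial sum passes to the limit. It stands in for
  completeness, as a limit found coordinate by coordinate inherits norm bounds that hold from some
  index on.\<close>

lemma l2norm_le_pointwise_limit: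
  assumes "\<And>i. i \<ge> M \<Longrightarrow> w i \<in> l2" "\<And>i. i \<ge> M \<Longrightarrow> l2norm (w i) \<le> B"
    and lim: "\<And>k. (\<lambda>i. w i k) \<longlonglongrightarrow> v k"
  shows "v \<in> l2" "l2norm v \<le> B"
proof -
  have B: "B \<ge> 0" using assms(1,2)[of M] l2norm_nonneg[of "w M"] by auto
  have "(\<Sum>k<N. (cmod (v k))\<^sup>2) \<le> B\<^sup>2" for N
  proof (rule LIMSEQ_le_const2)
    show "(\<lambda>i. \<Sum>k<N. (cmod (w i k))\<^sup>2) \<longlonglongrightarrow> (\<Sum>k<N. (cmod (v k))\<^sup>2)"
      by (intro tendsto_intros lim)
    show "\<exists>L. \<forall>i\<ge>L. (\<Sum>k<N. (cmod (w i k))\<^sup>2) \<le> B\<^sup>2"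
      using sum_le_l2norm[OF assms(1), of _ "{..<N}"] power_mono[OF assms(2) l2norm_nonneg[OF assms(1)]]
      by (intro exI[of _ M]) (meson finite_lessThan order_trans)
  qed
  with B show "v \<in> l2" "l2norm v \<le> B" by (auto intro!: l2I_norm_le)
qed

lemma l2norm_triangle_minus:
  assumes "u \<in> l2" "v \<in> l2"
  shows "l2norm (\<lambda>k. u k - v k) \<le> l2norm u + l2norm v"
  using l2_sum(2)[OF assms(1) l2_scale(1)[OF assms(2), of "-1"]] l2_scale(2)[OF assms(2), of "-1"]
  by simp

section \<open>Schur's test and the sesquilinear form of a nonnegative symmetric matrix\<close>

lemma schur_test_finite:
  fixes A :: "nat \<Rightarrow> nat \<Rightarrow> real"
  assumes nn: "\<And>j k. A j k \<ge> 0" and sym: "\<And>j k. A j k = A k j"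
    and row: "\<And>j N. (\<Sum>k<N. A j k) \<le> R"
  shows "(\<Sum>j<N. (cmod (\<Sum>k<K. complex_of_real (A j k) * v k))\<^sup>2) \<le> R\<^sup>2 * (\<Sum>k<K. (cmod (v k))\<^sup>2)"
proof -
  have R: "R \<ge> 0" using row[of 0 0] by simp
  have "(cmod (\<Sum>k<K. complex_of_real (A j k) * v k))\<^sup>2 \<le> R * (\<Sum>k<K. A j k * (cmod (v k))\<^sup>2)" for j
  proof -
    \<comment> \<open>Splitting each entry as sqrt(A) * sqrt(A) before Cauchy-Schwarz makes one
      factor a row sum. The other is later summed over j, where symmetry turns column sums into row
      sums. The cut-offs \<open>K\<close> and \<open>N\<close> are independent because
      \<open>K\<close> is sent to infinity first, for fixed \<open>N\<close>.\<close>
    have "cmod (\<Sum>k<K. complex_of_real (A j k) * v k) \<le> (\<Sum>k<K. sqrt (A j k) * (sqrt (A j k) * cmod (v k)))"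
      by (rule order_trans[OF norm_sum]) (auto intro!: sum_mono simp: norm_mult nn simp flip: mult.assoc)
    then have "(cmod (\<Sum>k<K. complex_of_real (A j k) * v k))\<^sup>2
        \<le> (\<Sum>k<K. sqrt (A j k) * (sqrt (A j k) * cmod (v k)))\<^sup>2"
      by (intro power_mono) auto
    also have "\<dots> \<le> (\<Sum>k<K. (sqrt (A j k))\<^sup>2) * (\<Sum>k<K. (sqrt (A j k) * cmod (v k))\<^sup>2)"
      by (rule Cauchy_Schwarz_ineq_sum)
    also have "\<dots> = (\<Sum>k<K. A j k) * (\<Sum>k<K. A j k * (cmod (v k))\<^sup>2)"
      by (simp add: nn power_mult_distrib)
    also have "\<dots> \<le> R * (\<Sum>k<K. A j k * (cmod (v k))\<^sup>2)"
      by (intro mult_right_mono row sum_nonneg) (auto simp: nn)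
    finally show ?thesis .
  qed
  then have "(\<Sum>j<N. (cmod (\<Sum>k<K. complex_of_real (A j k) * v k))\<^sup>2)
      \<le> (\<Sum>j<N. R * (\<Sum>k<K. A j k * (cmod (v k))\<^sup>2))"
    by (intro sum_mono) 
  also have "\<dots> = R * (\<Sum>k<K. (\<Sum>j<N. A k j) * (cmod (v k))\<^sup>2)"
    by (subst sum_distrib_left[symmetric], subst sum.swap) (simp add: sum_distrib_right sym)
  also have "\<dots> \<le> R * (\<Sum>k<K. R * (cmod (v k))\<^sup>2)"
    by (intro mult_left_mono sum_mono mult_right_mono row R) auto
  finally show ?thesis by (simp add: sum_distrib_left power2_eq_square mult.assoc)
qed

lemma schur_test_summable:
  fixes A :: "nat \<Rightarrow> nat \<Rightarrow> real"
  assumes nn: "\<And>j k. A j k \<ge> 0" and row: "\<And>j N. (\<Sum>k<N. A j k) \<le> R" and v: "v \<in> l2"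
  shows "summable (\<lambda>k. complex_of_real (A j k) * v k)"
proof -
  have "summable (\<lambda>k. A j k * l2norm v)"
    by (intro summable_mult2 summableI_nonneg_bounded[where x=R] nn row)
  then show ?thesis
    by (rule summable_comparison_test'[where N=0]) (auto simp: norm_mult nn intro!: mult_left_mono cmod_le_l2norm v)
qed

lemma schur_test:
  fixes A :: "nat \<Rightarrow> nat \<Rightarrow> real"
  assumes nn: "\<And>j k. A j k \<ge> 0" and sym: "\<And>j k. A j k = A k j"
    and row: "\<And>j N. (\<Sum>k<N. A j k) \<le> R"
  shows "bounded_matrix_op A R"
  unfolding bounded_matrix_op_def
proof (intro ballI conjI allI)
  fix v assume v: "v \<in> l2"
  have R: "R \<ge> 0" using row[of 0 0] by simp
  show sm: "summable (\<lambda>k. complex_of_real (A j k) * v k)" for j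
    using schur_test_summable[OF nn row v] .
  have "(\<Sum>j<N. (cmod (mat_apply A v j))\<^sup>2) \<le> (R * l2norm v)\<^sup>2" for N
  proof (rule LIMSEQ_le_const2)
    show "(\<lambda>K. \<Sum>j<N. (cmod (\<Sum>k<K. complex_of_real (A j k) * v k))\<^sup>2) \<longlonglongrightarrow> (\<Sum>j<N. (cmod (mat_apply A v j))\<^sup>2)"
      unfolding mat_apply_def by (intro tendsto_intros summable_LIMSEQ sm)
    show "\<exists>M. \<forall>K\<ge>M. (\<Sum>j<N. (cmod (\<Sum>k<K. complex_of_real (A j k) * v k))\<^sup>2) \<le> (R * l2norm v)\<^sup>2"
      using order_trans[OF schur_test_finite[OF nn sym row] mult_left_mono[OF sum_le_l2norm[OF v]]]
      by (intro exI[of _ 0]) (auto simp: power_mult_distrib)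
  qed
  then show "mat_apply A v \<in> l2" "l2norm (mat_apply A v) \<le> R * l2norm v"
    using R l2norm_nonneg[OF v] l2I_norm_le[of "R * l2norm v" "mat_apply A v"] by auto
qed

lemma mult_le_sum_squares: "x * y \<le> x\<^sup>2 + (y::real)\<^sup>2"
proof -
  have "0 \<le> x\<^sup>2 + y\<^sup>2 - 2 * (x * y)" using zero_le_power2[of "x - y"] by (simp add: power2_diff)
  then show ?thesis using zero_le_power2[of x] zero_le_power2[of y] by linarith
qed

lemma l2_product_summable:
  assumes "u \<in> l2" "v \<in> l2"
  shows "summable (\<lambda>k. u k * cnj (v k))"
proof (rule summable_comparison_test'[where N=0])
  show "summable (\<lambda>k. (cmod (u k))\<^sup>2 + (cmod (v k))\<^sup>2)"
    using assms by (intro summable_add) (auto simp: l2_def)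
qed (simp add: norm_mult mult_le_sum_squares)

text \<open>The inner product sums complete rows first, whereas positivity is known for finite
  square sections only. Absolute summability over all index pairs identifies both with one unordered
  sum.\<close>

lemma schur_form_LIMSEQ:
  fixes A :: "nat \<Rightarrow> nat \<Rightarrow> real"
  assumes nn: "\<And>j k. A j k \<ge> 0" and sym: "\<And>j k. A j k = A k j"
    and row: "\<And>j N. (\<Sum>k<N. A j k) \<le> R" and u: "u \<in> l2" and v: "v \<in> l2"
  shows "(\<lambda>N. \<Sum>j<N. \<Sum>k<N. complex_of_real (A j k) * u k * cnj (v j))
           \<longlonglongrightarrow> l2inner (mat_apply A u) v"
proof -
  define g where "g = (\<lambda>(j,k). complex_of_real (A j k) * u k * cnj (v j))"
  have R: "R \<ge> 0" using row[of 0 0] by simp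
  have rowf: "(\<Sum>k\<in>F. A j k) \<le> R" if "finite F" for j F
  proof -
    obtain N where "F \<subseteq> {..<N}" using \<open>finite F\<close> finite_nat_bounded by blast
    then have "(\<Sum>k\<in>F. A j k) \<le> (\<Sum>k<N. A j k)" by (intro sum_mono2) (auto simp: nn)
    then show ?thesis using row[of j N] by linarith
  qed
  \<comment> \<open>Bounding the product |u k| |v j| by the sum of squares separates
    \<open>u\<close> from \<open>v\<close>, so each half is controlled by row sums.\<close>
  have bd: "(\<Sum>x\<in>F. norm (g x)) \<le> R * (l2norm u)\<^sup>2 + R * (l2norm v)\<^sup>2" if "finite F" for F
  proof -
    have "finite (fst ` F \<union> snd ` F)" using that by simp
    then obtain N where N: "fst ` F \<union> snd ` F \<subseteq> {..<N}"
      using finite_nat_bounded by blast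
    then have "F \<subseteq> {..<N} \<times> {..<N}" by force
    then have "(\<Sum>x\<in>F. norm (g x)) \<le> (\<Sum>x\<in>{..<N} \<times> {..<N}. norm (g x))"
      by (intro sum_mono2) auto
    also have "\<dots> = (\<Sum>j<N. \<Sum>k<N. A j k * (cmod (u k) * cmod (v j)))"
      unfolding sum.cartesian_product by (intro sum.cong) (auto simp: g_def norm_mult nn)
    also have "\<dots> \<le> (\<Sum>j<N. \<Sum>k<N. A j k * ((cmod (u k))\<^sup>2 + (cmod (v j))\<^sup>2))"
    proof (intro sum_mono mult_left_mono nn)
      fix j k
      show "cmod (u k) * cmod (v j) \<le> (cmod (u k))\<^sup>2 + (cmod (v j))\<^sup>2"
        by (rule mult_le_sum_squares)
    qed
    also have "\<dots> = (\<Sum>k<N. (\<Sum>j<N. A k j) * (cmod (u k))\<^sup>2) + (\<Sum>j<N. (\<Sum>k<N. A j k) * (cmod (v j))\<^sup>2)"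
      by (simp add: distrib_left sum.distrib sum_distrib_right, subst sum.swap, simp add: sym)
    also have "\<dots> \<le> (\<Sum>k<N. R * (cmod (u k))\<^sup>2) + (\<Sum>j<N. R * (cmod (v j))\<^sup>2)"
      by (intro add_mono sum_mono mult_right_mono row) auto
    also have "\<dots> \<le> R * (l2norm u)\<^sup>2 + R * (l2norm v)\<^sup>2"
      unfolding sum_distrib_left[symmetric] 
      by (intro add_mono mult_left_mono sum_le_l2norm u v R) auto
    finally show ?thesis .
  qed
  have "(\<lambda>x. norm (g x)) summable_on UNIV"
    unfolding abs_summable_iff_bdd_above
    by (rule bdd_aboveI2[where M="R * (l2norm u)\<^sup>2 + R * (l2norm v)\<^sup>2"]) (use bd in auto)
  then have "g summable_on UNIV" by (rule abs_summable_summable)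
  then obtain S where S: "(g has_sum S) (UNIV \<times> UNIV)" by (auto simp: summable_on_def)
  have row_sum: "((\<lambda>k. g (j, k)) has_sum (mat_apply A u j * cnj (v j))) UNIV" for j
  proof (rule norm_summable_imp_has_sum)
    have "summable (\<lambda>k. complex_of_real (A j k) * u k)"
      using schur_test_summable[OF nn row u] .
    from sums_mult2[OF summable_sums[OF this], of "cnj (v j)"]
    show "(\<lambda>k. g (j, k)) sums (mat_apply A u j * cnj (v j))"
      by (simp add: g_def mat_apply_def)
    show "summable (\<lambda>k. norm (g (j, k)))"
    proof (rule summableI_nonneg_bounded)
      fix N
      have "(\<Sum>k<N. norm (g (j, k))) = (\<Sum>x\<in>(\<lambda>k. (j, k)) ` {..<N}. norm (g x))"
        by (subst sum.reindex) (auto intro: inj_onI)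
      also have "\<dots> \<le> R * (l2norm u)\<^sup>2 + R * (l2norm v)\<^sup>2" by (rule bd) auto
      finally show "(\<Sum>k<N. norm (g (j, k))) \<le> R * (l2norm u)\<^sup>2 + R * (l2norm v)\<^sup>2" .
    qed auto
  qed
  have "((\<lambda>j. mat_apply A u j * cnj (v j)) has_sum S) UNIV"
    by (rule has_sum_SigmaD[OF S row_sum])
  then have "l2inner (mat_apply A u) v = S"
    unfolding l2inner_def by (metis has_sum_imp_sums sums_unique)
  \<comment> \<open>The squares are cofinal among the finite sets of index pairs, so the unordered
    sum is also the limit along them.\<close>
  moreover have "(\<lambda>N. sum g ({..<N} \<times> {..<N})) \<longlonglongrightarrow> S"
  proof (rule filterlim_compose[of "sum g" _ "finite_subsets_at_top UNIV"])
    show "(sum g \<longlongrightarrow> S) (finite_subsets_at_top UNIV)" using S by (simp add: has_sum_def)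
    show "filterlim (\<lambda>N::nat. {..<N} \<times> {..<N}) (finite_subsets_at_top UNIV) sequentially"
      unfolding filterlim_finite_subsets_at_top
    proof (intro allI impI)
      fix X :: "(nat \<times> nat) set" assume "finite X \<and> X \<subseteq> UNIV"
      then obtain M where M: "fst ` X \<union> snd ` X \<subseteq> {..<M}"
        using finite_nat_bounded[of "fst ` X \<union> snd ` X"] by auto
      have "X \<subseteq> {..<N} \<times> {..<N}" if "N \<ge> M" for N using that M by force
      then show "\<forall>\<^sub>F N in sequentially. finite ({..<N} \<times> {..<N}) \<and> X \<subseteq> {..<N} \<times> {..<N} \<and> {..<N} \<times> {..<N} \<subseteq> UNIV"
        by (auto simp: eventually_sequentially)
    qed
  qed
  ultimately show ?thesis
    by (simp add: g_def flip: sum.cartesian_product)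
qed

text \<open>For a real symmetric matrix, conjugation and an exchange of indices turn the square
  sections of the form at (v, u) into those at (u, v). The limits therefore agree as well.\<close>

lemma schur_selfadjoint:
  fixes A :: "nat \<Rightarrow> nat \<Rightarrow> real"
  assumes nn: "\<And>j k. A j k \<ge> 0" and sym: "\<And>j k. A j k = A k j"
    and row: "\<And>j N. (\<Sum>k<N. A j k) \<le> R"
  shows "defines_selfadjoint_op A"
  unfolding defines_selfadjoint_op_def defines_bounded_op_def
proof (intro conjI ballI)
  show "\<exists>C. bounded_matrix_op A C" using schur_test[OF nn sym row] by blast
  fix u v assume uv: "u \<in> l2" "v \<in> l2"
  have "(\<lambda>N. cnj (\<Sum>j<N. \<Sum>k<N. complex_of_real (A j k) * v k * cnj (u j)))
           \<longlonglongrightarrow> cnj (l2inner (mat_apply A v) u)"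
    by (intro tendsto_cnj schur_form_LIMSEQ[OF nn sym row] uv)
  moreover have "cnj (\<Sum>j<N. \<Sum>k<N. complex_of_real (A j k) * v k * cnj (u j))
      = (\<Sum>j<N. \<Sum>k<N. complex_of_real (A j k) * u k * cnj (v j))" for N
    by (simp, subst sum.swap) (simp add: sym mult_ac)
  moreover have "cnj (l2inner (mat_apply A v) u) = l2inner u (mat_apply A v)"
  proof -
    have "cnj (suminf f) = (\<Sum>k. cnj (f k))" if "summable f" for f :: "nat \<Rightarrow> complex"
      using bounded_linear.suminf[OF bounded_linear_cnj that] .
    moreover have "summable (\<lambda>k. mat_apply A v k * cnj (u k))"
      using schur_test[OF nn sym row] uv by (intro l2_product_summable) (auto simp: bounded_matrix_op_def)
    ultimately show ?thesis by (simp add: l2inner_def mult.commute)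
  qed
  ultimately have "(\<lambda>N. \<Sum>j<N. \<Sum>k<N. complex_of_real (A j k) * u k * cnj (v j))
      \<longlonglongrightarrow> l2inner u (mat_apply A v)" by simp
  then show "l2inner (mat_apply A u) v = l2inner u (mat_apply A v)"
    using schur_form_LIMSEQ[OF nn sym row uv] LIMSEQ_unique by blast
qed

section \<open>Inversion of coercive operators\<close>

lemma l2norm_power2: "v \<in> l2 \<Longrightarrow> (l2norm v)\<^sup>2 = (\<Sum>k. (cmod (v k))\<^sup>2)"
  by (simp add: l2norm_def l2_def suminf_nonneg)

lemma l2norm_power2_diff:
  assumes v: "v \<in> l2" and w: "w \<in> l2"
  shows "(l2norm (\<lambda>k. v k - complex_of_real t * w k))\<^sup>2
    = (l2norm v)\<^sup>2 - 2 * t * Re (l2inner w v) + t\<^sup>2 * (l2norm w)\<^sup>2"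
proof -
  have eq: "(cmod (v k - complex_of_real t * w k))\<^sup>2
      = (cmod (v k))\<^sup>2 - 2 * t * Re (w k * cnj (v k)) + t\<^sup>2 * (cmod (w k))\<^sup>2" for k
    unfolding cmod_power2 by (simp add: power2_eq_square algebra_simps)
  have p: "(\<lambda>k. w k * cnj (v k)) sums l2inner w v"
    unfolding l2inner_def by (rule summable_sums[OF l2_product_summable[OF w v]])
  have "(\<lambda>k. (cmod (v k))\<^sup>2) sums (l2norm v)\<^sup>2" "(\<lambda>k. (cmod (w k))\<^sup>2) sums (l2norm w)\<^sup>2"
    using v w by (simp_all add: l2norm_power2 l2_def summable_sums)
  then have "(\<lambda>k. (cmod (v k - complex_of_real t * w k))\<^sup>2) sums
      ((l2norm v)\<^sup>2 - 2 * t * Re (l2inner w v) + t\<^sup>2 * (l2norm w)\<^sup>2)"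
    unfolding eq by (intro sums_add sums_diff sums_mult sums_Re p)
  moreover have "(\<lambda>k. v k - complex_of_real t * w k) \<in> l2"
    by (intro l2_diff l2_scale v w)
  ultimately show ?thesis by (simp add: l2norm_power2 sums_iff)
qed

lemma mat_apply_add_scale:
  assumes "bounded_matrix_op A R" "u \<in> l2" "v \<in> l2"
  shows "mat_apply A (\<lambda>k. u k + c * v k) = (\<lambda>j. mat_apply A u j + c * mat_apply A v j)"
proof
  fix j
  have "summable (\<lambda>k. complex_of_real (A j k) * u k)" "summable (\<lambda>k. complex_of_real (A j k) * v k)"
    using assms by (auto simp: bounded_matrix_op_def)
  from sums_add[OF summable_sums[OF this(1)] sums_mult[OF summable_sums[OF this(2)], of c]]
  show "mat_apply A (\<lambda>k. u k + c * v k) j = mat_apply A u j + c * mat_apply A v j"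
    by (simp add: mat_apply_def sums_iff algebra_simps)
qed

text \<open>Lax--Milgram: \<open>v \<mapsto> v - t A v\<close> contracts \<open>\<ell>\<^sup>2\<close> for small \<open>t\<close>, so \<open>A u = f\<close> is solved by
  \<open>u \<mapsto> u + t (f - A u)\<close>.\<close>
lemma coercive_invertible:
  assumes bdd: "bounded_matrix_op A R" and c: "c > 0"
    and coercive: "\<And>v. v \<in> l2 \<Longrightarrow> c * (l2norm v)\<^sup>2 \<le> Re (l2inner (mat_apply A v) v)"
  shows "defines_invertible_op A"
proof -
  \<comment> \<open>\<open>K\<close> bounds the operator, and K >= c keeps the radicand in
    \<open>q\<close> nonnegative. The choice t = c / K^2 minimises 1 - 2 t c + t^2 K^2, the squared
    contraction factor, with minimum 1 - (c / K)^2.\<close>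
  define K where "K = max R c"
  define t where "t = c / K\<^sup>2"
  define q where "q = sqrt (1 - (c / K)\<^sup>2)"
  have K: "K > 0" "c \<le> K" "R \<le> K" using c by (auto simp: K_def)
  have t: "t > 0" using K c by (simp add: t_def)
  have cK: "0 < c / K" "c / K \<le> 1" using c K by auto
  then have "(c / K)\<^sup>2 \<le> 1" "(c / K)\<^sup>2 > 0" by (auto simp: power_le_one)
  then have q: "0 \<le> q" "q < 1" "q\<^sup>2 = 1 - (c / K)\<^sup>2" by (auto simp: q_def)
  have Al2: "mat_apply A v \<in> l2" if "v \<in> l2" for v
    using bdd that by (auto simp: bounded_matrix_op_def)
  have AK: "l2norm (mat_apply A v) \<le> K * l2norm v" if "v \<in> l2" for v
    using bdd that K(3) mult_right_mono[OF K(3) l2norm_nonneg[OF that]]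
    unfolding bounded_matrix_op_def by fastforce
  define T where "T v = (\<lambda>k. v k - complex_of_real t * mat_apply A v k)" for v
  have Tl2: "T v \<in> l2" if "v \<in> l2" for v
    unfolding T_def by (intro l2_diff l2_scale Al2 that)
  have Tq: "l2norm (T v) \<le> q * l2norm v" if v: "v \<in> l2" for v
  proof -
    have "(l2norm (T v))\<^sup>2 = (l2norm v)\<^sup>2 - 2 * t * Re (l2inner (mat_apply A v) v) + t\<^sup>2 * (l2norm (mat_apply A v))\<^sup>2"
      unfolding T_def by (rule l2norm_power2_diff[OF v Al2[OF v]])
    also have "\<dots> \<le> (l2norm v)\<^sup>2 - 2 * t * (c * (l2norm v)\<^sup>2) + t\<^sup>2 * (K * l2norm v)\<^sup>2"
      using t coercive[OF v] AK[OF v] l2norm_nonneg[OF Al2[OF v]] l2norm_nonneg[OF v]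
      by (intro add_mono diff_mono mult_left_mono power_mono) auto
    also have "\<dots> = (1 - 2 * t * c + t\<^sup>2 * K\<^sup>2) * (l2norm v)\<^sup>2"
      by (simp add: algebra_simps power_mult_distrib)
    also have "1 - 2 * t * c + t\<^sup>2 * K\<^sup>2 = q\<^sup>2"
      unfolding q(3) using K(1) by (simp add: t_def power2_eq_square field_simps)
    finally have "(l2norm (T v))\<^sup>2 \<le> (q * l2norm v)\<^sup>2" by (simp add: power_mult_distrib)
    then show ?thesis using q l2norm_nonneg[OF v] by (simp add: power2_le_iff_abs_le)
  qed
  \<comment> \<open>Since v = T v + t A v and \<open>T\<close> contracts by \<open>q\<close>, (1 -
    q) |v| <= t |A v|. This yields both injectivity and a bounded inverse.\<close>
  have lower: "l2norm v \<le> t / (1 - q) * l2norm (mat_apply A v)" if v: "v \<in> l2" for v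
  proof -
    have "v = (\<lambda>k. T v k + complex_of_real t * mat_apply A v k)" by (simp add: T_def)
    then have "l2norm v \<le> l2norm (T v) + l2norm (\<lambda>k. complex_of_real t * mat_apply A v k)"
      using l2_sum(2)[OF Tl2[OF v] l2_scale(1)[OF Al2[OF v]]] by metis
    also have "\<dots> \<le> q * l2norm v + t * l2norm (mat_apply A v)"
      using Tq[OF v] l2_scale(2)[OF Al2[OF v], of "complex_of_real t"] t by simp
    finally show ?thesis using q by (simp add: field_simps)
  qed
  have inj: "inj_on (mat_apply A) l2"
  proof (rule inj_onI)
    fix u v assume uv: "u \<in> l2" "v \<in> l2" and e: "mat_apply A u = mat_apply A v"
    have d: "(\<lambda>k. u k + (-1) * v k) \<in> l2" using l2_diff[OF uv] by simp
    have "mat_apply A (\<lambda>k. u k + (-1) * v k) = (\<lambda>_. 0)"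
      by (subst mat_apply_add_scale[OF bdd uv]) (simp add: e)
    with lower[OF d] have "l2norm (\<lambda>k. u k + (-1) * v k) \<le> 0" by (simp add: l2norm_def)
    then have "l2norm (\<lambda>k. u k + (-1) * v k) = 0" using l2norm_nonneg[OF d] by simp
    from l2norm_eq_0[OF d this] show "u = v" by (auto simp: fun_eq_iff)
  qed
  have surj: "\<exists>u\<in>l2. mat_apply A u = f" if f: "f \<in> l2" for f
  proof -
    define u where "u = rec_nat (\<lambda>_. 0) (\<lambda>_ w k. w k + complex_of_real t * (f k - mat_apply A w k))"
    \<comment> \<open>The contraction is applied to the residuals: linearity gives r (N + 1) = T (r
      N), starting from r 0 = f, so they decay like q^N, and \<open>u\<close> moves by t * r N in
      each step.\<close>
    define r where "r N = (\<lambda>k. f k - mat_apply A (u N) k)" for N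
    have u0: "u 0 = (\<lambda>_. 0)" by (simp add: u_def)
    have uS: "u (Suc N) = (\<lambda>k. u N k + complex_of_real t * r N k)" for N by (simp add: u_def r_def)
    have ul2: "u N \<in> l2" for N
    proof (induction N)
      case 0 show ?case by (simp add: u0 l2_def)
    next
      case (Suc N) then show ?case unfolding uS r_def by (intro l2_sum l2_scale l2_diff f Al2)
    qed
    have rl2: "r N \<in> l2" for N unfolding r_def by (intro l2_diff f Al2 ul2)
    have rS: "r (Suc N) = T (r N)" for N
    proof -
      have "mat_apply A (u (Suc N)) = (\<lambda>j. mat_apply A (u N) j + complex_of_real t * mat_apply A (r N) j)"
        unfolding uS by (rule mat_apply_add_scale[OF bdd ul2 rl2])
      then show ?thesis by (simp add: T_def r_def[of "Suc N"]) (simp add: r_def fun_eq_iff)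
    qed
    have rq: "l2norm (r N) \<le> q ^ N * l2norm f" for N
    proof (induction N)
      case 0 show ?case by (simp add: r_def u0 mat_apply_def)
    next
      case (Suc N)
      have "l2norm (r (Suc N)) \<le> q * l2norm (r N)" unfolding rS by (rule Tq[OF rl2])
      also have "\<dots> \<le> q * (q ^ N * l2norm f)" by (rule mult_left_mono[OF Suc q(1)])
      finally show ?case by simp
    qed
    have nf: "0 \<le> l2norm f" by (rule l2norm_nonneg[OF f])
    \<comment> \<open>\<open>B N\<close> is the geometric tail, the sum of t q^i |f| over i >= N: an
      upper bound for the total length of all remaining steps.\<close>
    define B where "B N = t * l2norm f / (1 - q) * q ^ N" for N
    have B: "B N = t * (q ^ N * l2norm f) + B (Suc N)" "0 \<le> B N" for N
      using q t nf by (auto simp: B_def field_simps)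
    have diffl2: "(\<lambda>k. u M k - u N k) \<in> l2" for M N by (rule l2_diff[OF ul2 ul2])
    have tail: "l2norm (\<lambda>k. u (N + m) k - u N k) \<le> B N - B (N + m)" for N m
    proof (induction m)
      case 0 show ?case by (simp add: l2norm_def)
    next
      case (Suc m)
      have "(\<lambda>k. u (N + Suc m) k - u N k) = (\<lambda>k. (u (N + m) k - u N k) + complex_of_real t * r (N + m) k)"
        by (simp add: uS fun_eq_iff)
      then have "l2norm (\<lambda>k. u (N + Suc m) k - u N k)
          \<le> l2norm (\<lambda>k. u (N + m) k - u N k) + l2norm (\<lambda>k. complex_of_real t * r (N + m) k)"
        using l2_sum(2)[OF diffl2 l2_scale(1)[OF rl2]] by metis
      also have "\<dots> \<le> (B N - B (N + m)) + t * (q ^ (N + m) * l2norm f)"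
        using l2_scale(2)[OF rl2[of "N + m"], of "complex_of_real t"] t
        by (intro add_mono Suc) (simp add: mult_left_mono[OF rq])
      also have "\<dots> = B N - B (N + Suc m)" using B(1)[of "N + m"] by simp
      finally show ?case .
    qed
    \<comment> \<open>The limit is taken in each coordinate separately; the tail estimate then shows
      that it is a limit in norm.\<close>
    have "convergent (\<lambda>N. u N k)" for k
    proof -
      have "summable (\<lambda>N. u (Suc N) k - u N k)"
      proof (rule summable_comparison_test'[where N=0])
        show "summable (\<lambda>N. t * l2norm f * q ^ N)" using q by (intro summable_mult summable_geometric) simp
        fix N
        have "cmod (u (Suc N) k - u N k) = t * cmod (r N k)" using t by (simp add: uS norm_mult)
        also have "\<dots> \<le> t * (q ^ N * l2norm f)"
          using t cmod_le_l2norm[OF rl2, of N k] rq[of N] by (intro mult_left_mono) auto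
        finally show "norm (u (Suc N) k - u N k) \<le> t * l2norm f * q ^ N" by (simp add: mult_ac)
      qed
      then show ?thesis by (simp add: summable_iff_convergent sum_lessThan_telescope[of "\<lambda>N. u N k"] u0)
    qed
    then obtain w where w: "\<And>k. (\<lambda>N. u N k) \<longlonglongrightarrow> w k" unfolding convergent_def by metis
    have wN: "(\<lambda>k. w k - u N k) \<in> l2" "l2norm (\<lambda>k. w k - u N k) \<le> B N" for N
    proof -
      have b: "l2norm (\<lambda>k. u i k - u N k) \<le> B N" if "i \<ge> N" for i
        using tail[of N "i - N"] B(2)[of i] that by simp
      have l: "(\<lambda>i. u i k - u N k) \<longlonglongrightarrow> w k - u N k" for k by (intro tendsto_intros w)
      show "(\<lambda>k. w k - u N k) \<in> l2"
        by (rule l2norm_le_pointwise_limit(1)[OF diffl2 b l])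
      show "l2norm (\<lambda>k. w k - u N k) \<le> B N"
        by (rule l2norm_le_pointwise_limit(2)[OF diffl2 b l])
    qed
    have wl2: "w \<in> l2" using wN(1)[of 0] by (simp add: u0)
    have res: "l2norm (\<lambda>k. f k - mat_apply A w k) \<le> (l2norm f + K * (t * l2norm f / (1 - q))) * q ^ N" for N
    proof -
      have "w = (\<lambda>k. u N k + 1 * (w k - u N k))" by simp
      then have "mat_apply A w = (\<lambda>k. mat_apply A (u N) k + mat_apply A (\<lambda>k. w k - u N k) k)"
        using mat_apply_add_scale[OF bdd ul2[of N] wN(1)[of N], of 1] by simp
      then have "(\<lambda>k. f k - mat_apply A w k) = (\<lambda>k. r N k - mat_apply A (\<lambda>k. w k - u N k) k)"
        by (simp add: r_def fun_eq_iff)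
      then have "l2norm (\<lambda>k. f k - mat_apply A w k) \<le> l2norm (r N) + l2norm (mat_apply A (\<lambda>k. w k - u N k))"
        using l2norm_triangle_minus[OF rl2 Al2[OF wN(1)]] by simp
      also have "\<dots> \<le> q ^ N * l2norm f + K * B N"
        using K(1) by (intro add_mono rq order_trans[OF AK[OF wN(1)] mult_left_mono[OF wN(2)]]) auto
      finally show ?thesis by (simp add: B_def algebra_simps)
    qed
    have el2: "(\<lambda>k. f k - mat_apply A w k) \<in> l2" by (intro l2_diff f Al2 wl2)
    have "(\<lambda>N. (l2norm f + K * (t * l2norm f / (1 - q))) * q ^ N) \<longlonglongrightarrow> (l2norm f + K * (t * l2norm f / (1 - q))) * 0"
      using q by (intro tendsto_intros LIMSEQ_power_zero) simp
    then have "l2norm (\<lambda>k. f k - mat_apply A w k) \<le> 0"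
      using res by (intro LIMSEQ_le_const) auto
    then have "l2norm (\<lambda>k. f k - mat_apply A w k) = 0" using l2norm_nonneg[OF el2] by simp
    from l2norm_eq_0[OF el2 this] have "mat_apply A w = f" by (auto simp: fun_eq_iff)
    then show ?thesis using wl2 by blast
  qed
  show ?thesis
    unfolding defines_invertible_op_def defines_bounded_op_def bij_betw_def
  proof (intro conjI)
    show "\<exists>C. bounded_matrix_op A C" using bdd by blast
    show "inj_on (mat_apply A) l2" by (rule inj)
    show "mat_apply A ` l2 = l2" using surj Al2 by blast
    show "\<exists>C. \<forall>v\<in>l2. l2norm v \<le> C * l2norm (mat_apply A v)" using lower by blast
  qed
qed

subsection \<open>Packing\<close>

text \<open>The cylinder over a ball of radius \<open>r\<close> in the coordinate subspace \<open>D\<close> has volume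
  proportional to \<open>r\<^bsup>card D\<^esup>\<close>, which replaces Lebesgue measure on the subspace.\<close>
definition cylinder :: "'n::finite set \<Rightarrow> real \<Rightarrow> (real ^ 'n) set" where
  "cylinder D r = {y. norm (\<chi> i. if i \<in> D then y $ i else 0) < r \<and> (\<forall>i. i \<notin> D \<longrightarrow> \<bar>y $ i\<bar> < 1)}"

lemma cylinder_lmeasurable:
  fixes D :: "'n::finite set"
  shows "cylinder D r \<in> lmeasurable"
proof (rule lmeasurable_open)
  have "cylinder D r \<subseteq> cbox (\<chi> i. - (max r 1)) (\<chi> i. max r 1)"
  proof
    fix y assume y: "y \<in> cylinder D r"
    have "\<bar>y $ i\<bar> \<le> max r 1" for i
    proof (cases "i \<in> D")
      case True
      have "\<bar>(\<chi> i. if i \<in> D then y $ i else 0) $ i\<bar> \<le> norm (\<chi> i. if i \<in> D then y $ i else 0)"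
        by (rule component_le_norm_cart)
      moreover have "norm (\<chi> i. if i \<in> D then y $ i else 0) < r" using y by (simp add: cylinder_def)
      ultimately show ?thesis using True by simp
    next
      case False
      with y have "\<bar>y $ i\<bar> < 1" by (simp add: cylinder_def)
      then show ?thesis by simp
    qed
    then have "- (max r 1) \<le> y $ i \<and> y $ i \<le> max r 1" for i using abs_le_iff[of "y $ i"] by (smt (verit))
    then show "y \<in> cbox (\<chi> i. - (max r 1)) (\<chi> i. max r 1)" unfolding mem_box_cart vec_lambda_beta by blast
  qed
  then show "bounded (cylinder D r)" using bounded_cbox bounded_subset by blast
  have i: "continuous_on UNIV (\<lambda>y::real^'n. if i \<in> D then y $ i else 0)" for i
    by (cases "i \<in> D") (auto intro!: continuous_intros)
  have "continuous_on UNIV (\<lambda>y::real^'n. \<chi> i. if i \<in> D then y $ i else 0)"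
    by (rule continuous_on_vec_lambda[OF i])
  then have "open {y::real^'n. norm (\<chi> i. if i \<in> D then y $ i else 0) < r}"
    by (intro open_Collect_less continuous_on_norm continuous_on_const)
  moreover have "open {y::real^'n. \<bar>y $ i\<bar> < 1}" for i
    by (intro open_Collect_less continuous_intros)
  ultimately have "open ({y::real^'n. norm (\<chi> i. if i \<in> D then y $ i else 0) < r} \<inter> (\<Inter>i\<in>-D. {y. \<bar>y $ i\<bar> < 1}))"
    by (intro open_Int open_INT) auto
  then show "open (cylinder D r)"
    by (rule back_subst[where P="open"]) (auto simp: cylinder_def)
qed

text \<open>Stretching exactly the coordinates in \<open>D\<close> by r maps the unit cylinder onto
  the given one; the determinant is r^(card D), and the thickness in the other directions is
  kept.\<close>

lemma measure_cylinder:
  fixes D :: "'n::finite set"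
  assumes "r > 0"
  shows "measure lebesgue (cylinder D r) = r ^ card D * measure lebesgue (cylinder D 1)"
proof -
  define m where "m i = (if i \<in> D then r else 1)" for i
  have sc: "(\<chi> i. if i \<in> D then (\<chi> k. m k * x $ k) $ i else 0) = r *\<^sub>R (\<chi> i. if i \<in> D then x $ i else 0)" for x :: "real^'n"
    by (simp add: vec_eq_iff m_def)
  have 1: "(\<chi> k. m k * x $ k) \<in> cylinder D r \<longleftrightarrow> x \<in> cylinder D 1" for x
    using assms unfolding cylinder_def mem_Collect_eq sc by (auto simp: m_def)
  have "cylinder D r \<subseteq> (\<lambda>x. \<chi> k. m k * x $ k) ` cylinder D 1"
  proof
    fix y assume y: "y \<in> cylinder D r"
    define x where "x = (\<chi> k. y $ k / m k)"
    have yx: "y = (\<chi> k. m k * x $ k)" using assms by (simp add: x_def vec_eq_iff m_def)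
    with y 1 have "x \<in> cylinder D 1" by simp
    with yx show "y \<in> (\<lambda>x. \<chi> k. m k * x $ k) ` cylinder D 1" by blast
  qed
  with 1 have "cylinder D r = (\<lambda>x. \<chi> k. m k * x $ k) ` cylinder D 1" by blast
  moreover have "prod m UNIV = r ^ card D"
    by (simp add: m_def prod.If_cases)
  ultimately show ?thesis
    using measure_stretch[OF cylinder_lmeasurable, of m D 1] assms by simp
qed

lemma measure_cylinder_pos:
  fixes D :: "'n::finite set"
  shows "measure lebesgue (cylinder D 1) > 0"
proof -
  have "ball 0 1 \<subseteq> cylinder D 1"
  proof
    fix y :: "real^'n" assume "y \<in> ball 0 1"
    then have y: "norm y < 1" by simp
    have "norm (\<chi> i. if i \<in> D then y $ i else 0) \<le> norm y"
      by (rule norm_le_componentwise_cart) auto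
    moreover have "\<bar>y $ i\<bar> \<le> norm y" for i by (rule component_le_norm_cart)
    ultimately show "y \<in> cylinder D 1" using y by (auto simp: cylinder_def intro: le_less_trans)
  qed
  then have "measure lebesgue (ball (0::real^'n) 1) \<le> measure lebesgue (cylinder D 1)"
    by (intro measure_mono_fmeasurable cylinder_lmeasurable) auto
  moreover have "0 < measure lebesgue (ball (0::real^'n) 1)"
    using content_ball_pos[of 1 "0::real^'n"] by (simp add: measure_completion)
  ultimately show ?thesis by linarith
qed

text \<open>Volume comparison: cylinders of radius \<open>e\<close> about the points are disjoint,
  because the points differ only in the coordinates \<open>D\<close>, and all lie in the cylinder of
  radius r + e. The volume of the unit cylinder cancels.\<close>

lemma packing_coordinate_subspace:
  fixes y :: "'i \<Rightarrow> real ^ 'n"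
  assumes F: "finite F" and e: "e > 0"
    and sep: "\<And>j k. j \<in> F \<Longrightarrow> k \<in> F \<Longrightarrow> j \<noteq> k \<Longrightarrow> 2 * e \<le> dist (y j) (y k)"
    and D: "\<And>k i. k \<in> F \<Longrightarrow> i \<notin> D \<Longrightarrow> y k $ i = 0"
    and r: "r \<ge> 0" "\<And>k. k \<in> F \<Longrightarrow> norm (y k) \<le> r"
  shows "real (card F) * e ^ card D \<le> (r + e) ^ card D"
proof -
  define P where "P y = (\<chi> i. if i \<in> D then y $ i else 0)" for y :: "real^'n"
  have Padd: "P (u + v) = P u + P v" and Pdiff: "P (u - v) = P u - P v" for u v
    by (simp_all add: P_def vec_eq_iff)
  have Py: "P (y k) = y k" if "k \<in> F" for k using D that by (auto simp: P_def vec_eq_iff)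
  have cyl: "z \<in> cylinder D s \<longleftrightarrow> norm (P z) < s \<and> (\<forall>i. i \<notin> D \<longrightarrow> \<bar>z $ i\<bar> < 1)" for z s
    by (simp add: cylinder_def P_def)
  define C where "C k = (+) (y k) ` cylinder D e" for k
  have Cm: "C k \<in> lmeasurable" for k unfolding C_def by (intro measurable_translation cylinder_lmeasurable)
  have "disjoint_family_on C F"
    unfolding disjoint_family_on_def
  proof (intro ballI impI)
    fix j k assume jk: "j \<in> F" "k \<in> F" "j \<noteq> k"
    show "C j \<inter> C k = {}"
    proof (rule ccontr)
      assume "C j \<inter> C k \<noteq> {}"
      then obtain a b where ab: "a \<in> cylinder D e" "b \<in> cylinder D e" "y j + a = y k + b"
        unfolding C_def by blast
      then have "y j - y k = b - a" by (simp add: algebra_simps)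
      then have "P (y j) - P (y k) = P b - P a" by (metis Pdiff)
      then have "dist (y j) (y k) = norm (P b - P a)" using jk by (simp add: Py dist_norm)
      also have "\<dots> \<le> norm (P b) + norm (P a)" by (rule norm_triangle_ineq4)
      also have "\<dots> < 2 * e" using ab by (simp add: cyl)
      finally show False using sep[OF jk] by simp
    qed
  qed
  then have "measure lebesgue (\<Union>k\<in>F. C k) = (\<Sum>k\<in>F. measure lebesgue (C k))"
    using Cm by (intro measure_finite_Union F) (auto simp: emeasure_eq_measure2)
  also have "\<dots> = (\<Sum>k\<in>F. measure lebesgue (cylinder D e))"
    unfolding C_def by (simp add: measure_translation)
  also have "\<dots> = real (card F) * e ^ card D * measure lebesgue (cylinder D 1)"
    by (simp add: measure_cylinder[OF e])
  finally have 1: "measure lebesgue (\<Union>k\<in>F. C k) = real (card F) * e ^ card D * measure lebesgue (cylinder D 1)" .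
  have "(\<Union>k\<in>F. C k) \<subseteq> cylinder D (r + e)"
  proof
    fix w assume "w \<in> (\<Union>k\<in>F. C k)"
    then obtain k z where k: "k \<in> F" "w = y k + z" "z \<in> cylinder D e" by (auto simp: C_def)
    have "norm (P w) \<le> norm (y k) + norm (P z)"
      using k Padd Py norm_triangle_ineq by metis
    also have "\<dots> < r + e" using k r by (intro add_le_less_mono) (auto simp: cyl)
    finally show "w \<in> cylinder D (r + e)" using k D by (auto simp: cyl)
  qed
  then have "measure lebesgue (\<Union>k\<in>F. C k) \<le> measure lebesgue (cylinder D (r + e))"
    using Cm F by (intro measure_mono_fmeasurable cylinder_lmeasurable) (auto simp: fmeasurable_def)
  also have "\<dots> = (r + e) ^ card D * measure lebesgue (cylinder D 1)"
    using r e by (intro measure_cylinder) auto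
  finally show ?thesis using 1 measure_cylinder_pos[of D] by simp
qed

text \<open>A linear isometry carries \<open>S\<close> onto a coordinate subspace of the same
  dimension, and a translation moves \<open>p\<close> to the origin.\<close>

lemma packing_subspace:
  fixes x :: "'i \<Rightarrow> real ^ 'n"
  assumes S: "subspace S" "x ` F \<subseteq> S" "p \<in> S" and F: "finite F" and e: "\<delta> > 0"
    and sep: "\<And>j k. j \<in> F \<Longrightarrow> k \<in> F \<Longrightarrow> j \<noteq> k \<Longrightarrow> \<delta> \<le> dist (x j) (x k)"
    and r: "\<delta> \<le> r" "\<And>k. k \<in> F \<Longrightarrow> dist (x k) p \<le> r"
  shows "real (card F) \<le> (3 * r / \<delta>) ^ dim S"
proof -
  have "dim S \<le> CARD('n)" using dim_subset_UNIV_cart by blast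
  then obtain D :: "'n set" where D: "card D = dim S" 
    by (metis obtain_subset_with_card_n)
  define T :: "(real^'n) set" where "T = {y. \<forall>i. i \<notin> D \<longrightarrow> y $ i = 0}"
  have T: "subspace T" by (auto simp: T_def subspace_def)
  have "dim S = dim T"
    using dim_substandard_cart[of D, where 'a=real] D unfolding T_def dim_vec_eq by simp
  from isometry_subspaces[OF S(1) T this] obtain f where f: "linear f" "f ` S = T"
    and nf: "\<And>x. x \<in> S \<Longrightarrow> norm (f x) = norm x" by blast
  have df: "dist (f u) (f v) = dist u v" if "u \<in> S" "v \<in> S" for u v
    using nf[of "u - v"] that subspace_diff[OF S(1)] linear_diff[OF f(1)] by (metis dist_norm)
  define y where "y k = f (x k) - f p" for k
  have "real (card F) * (\<delta> / 2) ^ card D \<le> (r + \<delta> / 2) ^ card D"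
  proof (rule packing_coordinate_subspace[where y=y])
    show "2 * (\<delta> / 2) \<le> dist (y j) (y k)" if "j \<in> F" "k \<in> F" "j \<noteq> k" for j k
      using sep[OF that] df[of "x j" "x k"] S(2) that by (simp add: y_def image_subset_iff dist_norm)
    show "y k $ i = 0" if "k \<in> F" "i \<notin> D" for k i
    proof -
      have "f (x k) \<in> T" "f p \<in> T" using f(2) S that by auto
      then have "y k \<in> T" unfolding y_def by (rule subspace_diff[OF T])
      then show ?thesis using that by (simp add: T_def)
    qed
    show "norm (y k) \<le> r" if "k \<in> F" for k
      using r(2)[OF that] df[of "x k" p] S that by (simp add: y_def dist_norm[symmetric] image_subset_iff)
  qed (use F e r in auto)
  then have "real (card F) \<le> (r + \<delta> / 2) ^ card D / (\<delta> / 2) ^ card D"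
    using e by (subst pos_le_divide_eq) auto
  also have "\<dots> = ((r + \<delta> / 2) / (\<delta> / 2)) ^ card D" by (rule power_divide[symmetric])
  \<comment> \<open>The ratio is 2 r / \<delta> + 1, and \<delta> \<le> r absorbs the 1 into a third
    r / \<delta>.\<close>
  also have "\<dots> \<le> (3 * r / \<delta>) ^ card D"
    using e r(1) by (intro power_mono) (auto simp: field_simps)
  finally show ?thesis by (simp add: D)
qed

subsection \<open>Row sums\<close>

lemma sqrt_power_eq_powr: "x > 0 \<Longrightarrow> sqrt x ^ d = x powr (real d / 2)"
  by (simp add: powr_half_sqrt[symmetric] powr_power)

text \<open>Layer cake: write \<open>e\<^sup>-\<^sup>a\<close> as the integral of \<open>e\<^sup>-\<^sup>u\<close> over \<open>u \<ge> a\<close> and count, for each \<open>u\<close>, the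
  points that contribute.\<close>
lemma gaussian_sum_le:
  fixes \<rho> :: "'i \<Rightarrow> real"
  assumes F: "finite F" and \<delta>: "\<delta> > 0" and C: "C \<ge> 0" and far: "\<And>k. k \<in> F \<Longrightarrow> \<delta> \<le> \<rho> k"
    and count: "\<And>r. \<delta> \<le> r \<Longrightarrow> real (card {k \<in> F. \<rho> k \<le> r}) \<le> C * (r / \<delta>) ^ d"
    and s: "s > 0"
  shows "(\<Sum>k\<in>F. exp (- (\<rho> k)\<^sup>2 / (4 * s))) \<le> C * 2 ^ d * Gamma (real d / 2 + 1) / \<delta> ^ d * s powr (real d / 2)"
proof -
  define a where "a k = (\<rho> k)\<^sup>2 / (4 * s)" for k
  define K where "K = C * 2 ^ d / \<delta> ^ d * s powr (real d / 2)"
  have "((\<lambda>u. if u \<in> {a k..} then exp (- 1 * u) else 0) has_integral exp (- 1 * a k) / 1) {0<..}" if "k \<in> F" for k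
  proof -
    have "a k > 0" using far[OF that] \<delta> s by (auto simp: a_def)
    then have "{a k..} \<subseteq> {0<..}" by auto
    then show ?thesis
      using has_integral_exp_minus_to_infinity[of 1 "a k"] by (subst has_integral_restrict) auto
  qed
  from has_integral_sum[OF F this]
  have 1: "((\<lambda>u. \<Sum>k\<in>F. if u \<in> {a k..} then exp (- 1 * u) else 0) has_integral (\<Sum>k\<in>F. exp (- 1 * a k) / 1)) {0<..}" .
  have 2: "((\<lambda>u. K * (u powr ((real d / 2 + 1) - 1) / exp u)) has_integral K * Gamma (real d / 2 + 1)) {0<..}"
    by (intro has_integral_mult_right Gamma_kernel_absolutely_integrable(2)) simp
  have 3: "(\<Sum>k\<in>F. if u \<in> {a k..} then exp (- 1 * u) else 0) \<le> K * (u powr ((real d / 2 + 1) - 1) / exp u)"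
    if "u \<in> {0<..}" for u
  proof -
    have u: "u > 0" using that by simp
    define r where "r = sqrt (4 * s * u)"
    have le: "a k \<le> u \<longleftrightarrow> \<rho> k \<le> r" if "k \<in> F" for k
    proof -
      have "\<rho> k > 0" using far[OF that] \<delta> by linarith
      then have "\<rho> k \<le> r \<longleftrightarrow> (\<rho> k)\<^sup>2 \<le> 4 * s * u"
        unfolding r_def using real_sqrt_le_iff[of "(\<rho> k)\<^sup>2" "4 * s * u"] by simp
      then show ?thesis using s by (simp add: a_def field_simps)
    qed
    have "(\<Sum>k\<in>F. if u \<in> {a k..} then exp (- 1 * u) else 0) = real (card {k\<in>F. \<rho> k \<le> r}) * exp (- u)"
      using F by (simp add: le sum.inter_filter[symmetric] cong: sum.cong conj_cong)
    also have "\<dots> \<le> (K * u powr (real d / 2)) * exp (- u)"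
    proof (rule mult_right_mono)
      show "real (card {k\<in>F. \<rho> k \<le> r}) \<le> K * u powr (real d / 2)"
      proof (cases "\<delta> \<le> r")
        case True
        have rd: "r ^ d = 2 ^ d * (s powr (real d / 2) * u powr (real d / 2))"
          using s u by (simp add: r_def real_sqrt_mult power_mult_distrib sqrt_power_eq_powr)
        have "C * (r / \<delta>) ^ d = K * u powr (real d / 2)"
          unfolding power_divide rd K_def by simp
        then show ?thesis using count[OF True] by linarith
      next
        \<comment> \<open>The counting hypothesis is silent below \<delta>, but no point of
          \<open>F\<close> lies that close.\<close>
        case False
        then have e: "{k\<in>F. \<rho> k \<le> r} = {}" using far by fastforce
        have "0 \<le> K * u powr (real d / 2)" using C \<delta> by (simp add: K_def)
        then show ?thesis unfolding e card.empty of_nat_0 .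
      qed
    qed simp
    also have "\<dots> = K * (u powr ((real d / 2 + 1) - 1) / exp u)"
      by (simp add: exp_minus inverse_eq_divide)
    finally show ?thesis .
  qed
  have "(\<Sum>k\<in>F. exp (- 1 * a k) / 1) \<le> K * Gamma (real d / 2 + 1)"
    by (rule has_integral_le[OF 1 2 3])
  then show ?thesis by (simp add: a_def K_def mult_ac)
qed

text \<open>Integrating the Gaussian estimate against the Gamma kernel, the factor s^(d/2) shifts
  the parameter of Gamma from \<alpha> to \<alpha> + d/2.\<close>

lemma matern_sum_le:
  fixes \<rho> :: "'i \<Rightarrow> real"
  assumes \<alpha>: "\<alpha> > 0" and F: "finite F" and \<delta>: "\<delta> > 0" and C: "C \<ge> 0" and far: "\<And>k. k \<in> F \<Longrightarrow> \<delta> \<le> \<rho> k"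
    and count: "\<And>r. \<delta> \<le> r \<Longrightarrow> real (card {k \<in> F. \<rho> k \<le> r}) \<le> C * (r / \<delta>) ^ d"
  shows "(\<Sum>k\<in>F. matern \<alpha> (\<rho> k)) \<le> C * 2 ^ d * Gamma (real d / 2 + 1) * Gamma (\<alpha> + real d / 2) / (\<delta> ^ d * Gamma \<alpha>)"
proof -
  define K where "K = C * 2 ^ d * Gamma (real d / 2 + 1) / \<delta> ^ d"
  have G: "Gamma \<alpha> > 0" using Gamma_real_pos[OF \<alpha>] .
  have "((\<lambda>s. \<Sum>k\<in>F. s powr (\<alpha> - 1) / exp s * exp (- (\<rho> k)\<^sup>2 / (4 * s))) has_integral (\<Sum>k\<in>F. matern \<alpha> (\<rho> k) * Gamma \<alpha>)) {0<..}"
    using far \<delta> by (intro has_integral_sum F matern_has_integral \<alpha>) force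
  moreover have "((\<lambda>s. K * (s powr ((\<alpha> + real d / 2) - 1) / exp s)) has_integral K * Gamma (\<alpha> + real d / 2)) {0<..}"
    using \<alpha> by (intro has_integral_mult_right Gamma_kernel_absolutely_integrable(2)) (simp add: add_pos_nonneg)
  moreover have "(\<Sum>k\<in>F. s powr (\<alpha> - 1) / exp s * exp (- (\<rho> k)\<^sup>2 / (4 * s))) \<le> K * (s powr ((\<alpha> + real d / 2) - 1) / exp s)"
    if "s \<in> {0<..}" for s
  proof -
    have s: "s > 0" using that by simp
    have "(\<Sum>k\<in>F. s powr (\<alpha> - 1) / exp s * exp (- (\<rho> k)\<^sup>2 / (4 * s)))
        = s powr (\<alpha> - 1) / exp s * (\<Sum>k\<in>F. exp (- (\<rho> k)\<^sup>2 / (4 * s)))"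
      by (simp add: sum_distrib_left)
    also have "\<dots> \<le> s powr (\<alpha> - 1) / exp s * (K * s powr (real d / 2))"
      unfolding K_def by (intro mult_left_mono gaussian_sum_le F \<delta> C far count s) auto
    also have "\<dots> = K * (s powr ((\<alpha> + real d / 2) - 1) / exp s)"
      using powr_add[of s "\<alpha> - 1" "real d / 2"] by (simp add: algebra_simps)
    finally show ?thesis .
  qed
  ultimately have "(\<Sum>k\<in>F. matern \<alpha> (\<rho> k) * Gamma \<alpha>) \<le> K * Gamma (\<alpha> + real d / 2)"
    by (rule has_integral_le)
  then have "(\<Sum>k\<in>F. matern \<alpha> (\<rho> k)) \<le> K * Gamma (\<alpha> + real d / 2) / Gamma \<alpha>"
    using G by (simp add: pos_le_divide_eq sum_distrib_right)
  then show ?thesis by (simp add: K_def field_simps)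
qed

subsection \<open>Positive definiteness\<close>

text \<open>Expanding one inner product in the orthonormal basis and absorbing its coordinates into
  the coefficients leaves a sum of forms with exponent one less. Hence the induction over arbitrary
  \<open>c\<close>.\<close>

lemma inner_power_positive_semidefinite:
  fixes x :: "'i \<Rightarrow> 'a::euclidean_space" and c :: "'i \<Rightarrow> real"
  shows "0 \<le> (\<Sum>j\<in>F. \<Sum>k\<in>F. c j * c k * (x j \<bullet> x k) ^ m)"
proof (induction m arbitrary: c)
  case 0
  have "(\<Sum>j\<in>F. \<Sum>k\<in>F. c j * c k) = (\<Sum>j\<in>F. c j)\<^sup>2"
    by (simp add: power2_eq_square sum_product)
  then show ?case by simp
next
  case (Suc m)
  have "c j * c k * (x j \<bullet> x k) ^ Suc m
      = (\<Sum>b\<in>Basis. (c j * (x j \<bullet> b)) * (c k * (x k \<bullet> b)) * (x j \<bullet> x k) ^ m)" for j k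
  proof -
    have "c j * c k * (x j \<bullet> x k) ^ Suc m = (x j \<bullet> x k) * (c j * c k * (x j \<bullet> x k) ^ m)" by simp
    also have "\<dots> = (\<Sum>b\<in>Basis. (x j \<bullet> b) * (x k \<bullet> b)) * (c j * c k * (x j \<bullet> x k) ^ m)"
      by (rule arg_cong[where f="\<lambda>y. y * _", OF euclidean_inner])
    also have "\<dots> = (\<Sum>b\<in>Basis. (c j * (x j \<bullet> b)) * (c k * (x k \<bullet> b)) * (x j \<bullet> x k) ^ m)"
      unfolding sum_distrib_right by (intro sum.cong refl) (simp only: mult_ac)
    finally show ?thesis .
  qed
  then have "(\<Sum>j\<in>F. \<Sum>k\<in>F. c j * c k * (x j \<bullet> x k) ^ Suc m)
      = (\<Sum>j\<in>F. \<Sum>k\<in>F. \<Sum>b\<in>Basis. (c j * (x j \<bullet> b)) * (c k * (x k \<bullet> b)) * (x j \<bullet> x k) ^ m)"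
    by (simp only:)
  also have "\<dots> = (\<Sum>j\<in>F. \<Sum>b\<in>Basis. \<Sum>k\<in>F. (c j * (x j \<bullet> b)) * (c k * (x k \<bullet> b)) * (x j \<bullet> x k) ^ m)"
    by (intro sum.cong refl sum.swap)
  also have "\<dots> = (\<Sum>b\<in>Basis. \<Sum>j\<in>F. \<Sum>k\<in>F. (c j * (x j \<bullet> b)) * (c k * (x k \<bullet> b)) * (x j \<bullet> x k) ^ m)"
    by (rule sum.swap)
  also have "\<dots> \<ge> 0" by (intro sum_nonneg Suc.IH)
  finally show ?case .
qed

text \<open>The exponential series has nonnegative coefficients, so positivity passes from the
  powers to their sum.\<close>

lemma exp_inner_positive_semidefinite:
  fixes x :: "'i \<Rightarrow> 'a::euclidean_space" and c :: "'i \<Rightarrow> real"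
  assumes "t \<ge> 0"
  shows "0 \<le> (\<Sum>j\<in>F. \<Sum>k\<in>F. c j * c k * exp (t * (x j \<bullet> x k)))"
proof -
  have S: "(\<lambda>m. \<Sum>j\<in>F. \<Sum>k\<in>F. c j * c k * ((t * (x j \<bullet> x k)) ^ m /\<^sub>R fact m)) sums
      (\<Sum>j\<in>F. \<Sum>k\<in>F. c j * c k * exp (t * (x j \<bullet> x k)))"
    by (intro sums_sum sums_mult exp_converges)
  have N: "0 \<le> (\<Sum>j\<in>F. \<Sum>k\<in>F. c j * c k * ((t * (x j \<bullet> x k)) ^ m /\<^sub>R fact m))" for m
  proof -
    have "(\<Sum>j\<in>F. \<Sum>k\<in>F. c j * c k * ((t * (x j \<bullet> x k)) ^ m /\<^sub>R fact m))
        = t ^ m / fact m * (\<Sum>j\<in>F. \<Sum>k\<in>F. c j * c k * (x j \<bullet> x k) ^ m)"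
      unfolding sum_distrib_left by (intro sum.cong refl) (simp only: power_mult_distrib real_scaleR_def divide_inverse mult_ac)
    then show ?thesis using assms inner_power_positive_semidefinite[of c x m F] by simp
  qed
  show ?thesis by (rule sums_le[OF N sums_zero S])
qed

text \<open>Expanding the squared distance leaves one factor for each point alone, absorbed into the
  coefficients \<open>b\<close>, and the exponential of an inner product.\<close>

lemma gaussian_positive_semidefinite:
  fixes x :: "'i \<Rightarrow> 'a::euclidean_space" and c :: "'i \<Rightarrow> real"
  assumes "s > 0"
  shows "0 \<le> (\<Sum>j\<in>F. \<Sum>k\<in>F. c j * c k * exp (- (dist (x j) (x k))\<^sup>2 / (4 * s)))"
proof -
  define b where "b j = c j * exp (- (x j \<bullet> x j) / (4 * s))" for j
  have "c j * c k * exp (- (dist (x j) (x k))\<^sup>2 / (4 * s)) = b j * b k * exp (1 / (2 * s) * (x j \<bullet> x k))" for j k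
  proof -
    have d: "(dist (x j) (x k))\<^sup>2 = x j \<bullet> x j + x k \<bullet> x k - 2 * (x j \<bullet> x k)"
      by (simp add: dist_norm power2_norm_eq_inner inner_diff inner_commute[of "x k" "x j"])
    have "- (dist (x j) (x k))\<^sup>2 / (4 * s) = - (x j \<bullet> x j) / (4 * s) + - (x k \<bullet> x k) / (4 * s) + 1 / (2 * s) * (x j \<bullet> x k)"
      unfolding d using assms by (simp add: field_simps)
    then have "exp (- (dist (x j) (x k))\<^sup>2 / (4 * s))
        = exp (- (x j \<bullet> x j) / (4 * s)) * exp (- (x k \<bullet> x k) / (4 * s)) * exp (1 / (2 * s) * (x j \<bullet> x k))"
      by (simp only: exp_add)
    then show ?thesis by (simp only: b_def mult_ac)
  qed
  then show ?thesis using exp_inner_positive_semidefinite[of "1 / (2 * s)" b x F] assms by simp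
qed

text \<open>Summing (c j + c k)^2 * H j k >= 0 bounds the cross terms below by minus the sum of (c
  j)^2 * H j k, the two square terms being equal by symmetry.\<close>

lemma quadratic_form_ge_of_row_sums:
  fixes H :: "'i \<Rightarrow> 'i \<Rightarrow> real"
  assumes "\<And>j k. H j k \<ge> 0" "\<And>j k. H j k = H k j" "\<And>j. j \<in> F \<Longrightarrow> (\<Sum>k\<in>F. H j k) \<le> q"
  shows "(\<Sum>j\<in>F. \<Sum>k\<in>F. c j * c k * H j k) \<ge> - q * (\<Sum>j\<in>F. (c j)\<^sup>2)"
proof -
  have "(\<Sum>j\<in>F. \<Sum>k\<in>F. (c j)\<^sup>2 * H j k) = (\<Sum>j\<in>F. (c j)\<^sup>2 * (\<Sum>k\<in>F. H j k))"
    by (simp only: sum_distrib_left)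
  also have "\<dots> \<le> (\<Sum>j\<in>F. (c j)\<^sup>2 * q)"
    by (intro sum_mono mult_left_mono assms) auto
  also have "\<dots> = q * (\<Sum>j\<in>F. (c j)\<^sup>2)"
    by (simp add: sum_distrib_left mult.commute)
  finally have e: "(\<Sum>j\<in>F. \<Sum>k\<in>F. (c j)\<^sup>2 * H j k) \<le> q * (\<Sum>j\<in>F. (c j)\<^sup>2)" .
  have "(\<Sum>j\<in>F. \<Sum>k\<in>F. (c k)\<^sup>2 * H j k) = (\<Sum>j\<in>F. \<Sum>k\<in>F. (c j)\<^sup>2 * H j k)"
    by (subst sum.swap) (simp add: assms(2))
  moreover have "0 \<le> (\<Sum>j\<in>F. \<Sum>k\<in>F. (c j + c k)\<^sup>2 * H j k)"
    by (intro sum_nonneg mult_nonneg_nonneg assms) auto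
  moreover have "(c j + c k)\<^sup>2 * H j k = (c j)\<^sup>2 * H j k + (c k)\<^sup>2 * H j k + 2 * (c j * c k * H j k)" for j k
    by (simp add: power2_sum algebra_simps)
  then have "(\<Sum>j\<in>F. \<Sum>k\<in>F. (c j + c k)\<^sup>2 * H j k)
      = (\<Sum>j\<in>F. \<Sum>k\<in>F. (c j)\<^sup>2 * H j k) + (\<Sum>j\<in>F. \<Sum>k\<in>F. (c k)\<^sup>2 * H j k) + 2 * (\<Sum>j\<in>F. \<Sum>k\<in>F. c j * c k * H j k)"
    by (simp only: sum.distrib sum_distrib_left)
  ultimately show ?thesis using e by simp
qed

lemma quadratic_form_diagonally_dominant:
  fixes G :: "'i \<Rightarrow> 'i \<Rightarrow> real"
  assumes F: "finite F" and nn: "\<And>j k. G j k \<ge> 0" and sym: "\<And>j k. G j k = G k j" and diag: "\<And>j. G j j = 1"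
    and row: "\<And>j. j \<in> F \<Longrightarrow> (\<Sum>k\<in>F - {j}. G j k) \<le> q"
  shows "(\<Sum>j\<in>F. \<Sum>k\<in>F. c j * c k * G j k) \<ge> (1 - q) * (\<Sum>j\<in>F. (c j)\<^sup>2)"
proof -
  define H where "H j k = (if j = k then 0 else G j k)" for j k
  have eq: "c j * c k * G j k = c j * c k * H j k + (if j = k then (c j)\<^sup>2 else 0)" for j k
    by (simp add: H_def diag power2_eq_square)
  have "(\<Sum>j\<in>F. \<Sum>k\<in>F. c j * c k * G j k) = (\<Sum>j\<in>F. \<Sum>k\<in>F. c j * c k * H j k) + (\<Sum>j\<in>F. (c j)\<^sup>2)"
    unfolding eq by (simp add: sum.distrib F)
  moreover have "(\<Sum>k\<in>F. H j k) \<le> q" if "j \<in> F" for j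
  proof -
    have "(\<Sum>k\<in>F. H j k) = (\<Sum>k\<in>F - {j}. H j k)"
      using sum.remove[OF F that, of "H j"] by (simp add: H_def)
    also have "\<dots> = (\<Sum>k\<in>F - {j}. G j k)"
      by (intro sum.cong refl) (auto simp: H_def)
    finally have "(\<Sum>k\<in>F. H j k) = (\<Sum>k\<in>F - {j}. G j k)" .
    then show ?thesis using row[OF that] by simp
  qed
  then have "(\<Sum>j\<in>F. \<Sum>k\<in>F. c j * c k * H j k) \<ge> - q * (\<Sum>j\<in>F. (c j)\<^sup>2)"
    by (intro quadratic_form_ge_of_row_sums) (auto simp: H_def nn sym)
  ultimately show ?thesis by (simp add: algebra_simps)
qed

section \<open>Estimates for the Schoenberg matrix\<close>

lemma matern_nonneg:
  assumes "\<alpha> > 0" "z \<ge> 0"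
  shows "0 \<le> matern \<alpha> z"
proof -
  have "0 \<le> matern \<alpha> z * Gamma \<alpha>"
    by (rule has_integral_nonneg[OF matern_has_integral[OF assms]]) auto
  then show ?thesis using Gamma_real_pos[OF assms(1)] mult_neg_pos[of "matern \<alpha> z" "Gamma \<alpha>"] by linarith
qed

lemma separated_ball_count:
  fixes x :: "nat \<Rightarrow> real ^ 'n"
  assumes \<delta>: "\<delta> > 0" and sep: "\<And>j k. j \<noteq> k \<Longrightarrow> \<delta> \<le> dist (x j) (x k)"
    and d: "dim (span (range x)) = d" "1 \<le> d" and F: "finite F" and r: "\<delta> \<le> r"
  shows "real (card {k \<in> F. dist (x j) (x k) \<le> r}) \<le> (5 ^ d - 1) * (r / \<delta>) ^ d"
proof -
  \<comment> \<open>This trades the packing constant for the one in the stated bound; it relies on d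
    >= 1.\<close>
  have "(3::real) ^ d + 1 \<le> 5 ^ d"
    using d(2)
  proof (induction d rule: nat_induct_at_least)
    case (Suc n)
    have "0 \<le> (3::real) ^ n" by simp
    with Suc.IH show ?case unfolding power_Suc by linarith
  qed simp
  have "real (card {k \<in> F. dist (x j) (x k) \<le> r}) \<le> (3 * r / \<delta>) ^ dim (span (range x))"
    using F \<delta> sep r
    by (intro packing_subspace[where x=x and p="x j"]) (auto simp: dist_commute intro: span_base)
  also have "\<dots> = 3 ^ d * (r / \<delta>) ^ d"
    unfolding d(1) by (simp add: power_mult_distrib[symmetric])
  also have "\<dots> \<le> (5 ^ d - 1) * (r / \<delta>) ^ d"
    using \<open>3 ^ d + 1 \<le> 5 ^ d\<close> \<delta> r by (intro mult_right_mono) auto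
  finally show ?thesis .
qed

lemma matern_row_sum_le:
  fixes x :: "nat \<Rightarrow> real ^ 'n"
  assumes \<alpha>: "\<alpha> > 0" and \<delta>: "\<delta> > 0" and sep: "\<And>j k. j \<noteq> k \<Longrightarrow> \<delta> \<le> dist (x j) (x k)"
    and d: "dim (span (range x)) = d" "1 \<le> d"
  shows "(\<Sum>k<N. matern \<alpha> (dist (x j) (x k)))
    \<le> 1 + real d * 2 ^ (d - 1) * (5 ^ d - 1) * Gamma (\<alpha> + real d / 2) * Gamma (real d / 2) / (\<delta> ^ d * Gamma \<alpha>)"
proof -
  \<comment> \<open>The index \<open>j\<close> may be at least \<open>N\<close>; inserting it adds a
    nonnegative term and lets the diagonal entry 1 be split off in every case.\<close>
  have "(\<Sum>k<N. matern \<alpha> (dist (x j) (x k))) \<le> (\<Sum>k\<in>insert j ({..<N} - {j}). matern \<alpha> (dist (x j) (x k)))"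
    using matern_nonneg[OF \<alpha>] by (intro sum_mono2) auto
  also have "\<dots> = 1 + (\<Sum>k\<in>{..<N} - {j}. matern \<alpha> (dist (x j) (x k)))"
    by (subst sum.insert) (auto simp: matern_def)
  also have "(\<Sum>k\<in>{..<N} - {j}. matern \<alpha> (dist (x j) (x k)))
      \<le> (5 ^ d - 1) * 2 ^ d * Gamma (real d / 2 + 1) * Gamma (\<alpha> + real d / 2) / (\<delta> ^ d * Gamma \<alpha>)"
    using sep by (intro matern_sum_le \<alpha> \<delta> separated_ball_count[OF \<delta> sep d]) auto
  finally have le: "(\<Sum>k<N. matern \<alpha> (dist (x j) (x k)))
      \<le> 1 + (5 ^ d - 1) * 2 ^ d * Gamma (real d / 2 + 1) * Gamma (\<alpha> + real d / 2) / (\<delta> ^ d * Gamma \<alpha>)"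
    by simp
  \<comment> \<open>Rewrites 2^d Gamma(d/2 + 1) as d 2^(d-1) Gamma(d/2). Here d >= 1 keeps d/2 off
    the poles of Gamma and \<open>d - 1\<close> untruncated.\<close>
  have "real d / 2 \<notin> \<int>\<^sub>\<le>\<^sub>0" using d(2) nonpos_Ints_nonpos[of "real d / 2"] by auto
  from Gamma_plus1[OF this] have G: "Gamma (real d / 2 + 1) = real d / 2 * Gamma (real d / 2)" .
  have "(2::real) ^ d = 2 * 2 ^ (d - 1)" using d(2) by (cases d) auto
  then have e: "(5 ^ d - 1) * 2 ^ d * Gamma (real d / 2 + 1) * Gamma (\<alpha> + real d / 2)
      = real d * 2 ^ (d - 1) * (5 ^ d - 1) * Gamma (\<alpha> + real d / 2) * Gamma (real d / 2)"
    unfolding G by simp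
  show ?thesis using le unfolding e .
qed

text \<open>All Gaussians of the mixture are positive semidefinite, and the concentrated ones
  (small \<open>s\<close>) are even diagonally dominant; these contribute the positive lower bound.\<close>
lemma matern_coercive:
  fixes x :: "nat \<Rightarrow> real ^ 'n"
  assumes \<alpha>: "\<alpha> > 0" and \<delta>: "\<delta> > 0" and sep: "\<And>j k. j \<noteq> k \<Longrightarrow> \<delta> \<le> dist (x j) (x k)"
    and d: "dim (span (range x)) = d" "1 \<le> d"
  obtains c where "c > 0"
    "\<And>N v. c * (\<Sum>j<N. (v j)\<^sup>2) \<le> (\<Sum>j<N. \<Sum>k<N. v j * v k * matern \<alpha> (dist (x j) (x k)))"
proof -
  have G: "Gamma \<alpha> > 0" using Gamma_real_pos[OF \<alpha>] .
  define K where "K = (5 ^ d - 1) * 2 ^ d * Gamma (real d / 2 + 1) / \<delta> ^ d"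
  have "(1::real) < 5 ^ d" using d(2) by (intro one_less_power) auto
  then have K: "K > 0" using \<delta> by (auto simp: K_def intro!: divide_pos_pos mult_pos_pos Gamma_real_pos)
  \<comment> \<open>Chosen so that K s0^(d/2) = 1/2: up to this scale the off-diagonal row sums are
    at most 1/2.\<close>
  define s0 where "s0 = (1 / (2 * K)) powr (2 / real d)"
  have s0: "s0 > 0" using K by (simp add: s0_def)
  have small: "K * s powr (real d / 2) \<le> 1 / 2" if "0 < s" "s \<le> s0" for s
  proof -
    have "s powr (real d / 2) \<le> s0 powr (real d / 2)" using that by (intro powr_mono2) auto
    also have "\<dots> = 1 / (2 * K)" using d(2) K by (simp add: s0_def powr_powr)
    finally show ?thesis using K by (simp add: field_simps)
  qed
  define g where "g s = s powr (\<alpha> - 1) / exp s" for s :: real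
  have g0: "g s \<ge> 0" for s by (simp add: g_def)
  \<comment> \<open>The kernel may vanish as s tends to 0 (for \<alpha> > 1), so only the upper half
    of the interval is used, where compactness gives a positive minimum.\<close>
  obtain m where m: "m > 0" "\<And>s. s \<in> {s0/2..s0} \<Longrightarrow> m \<le> g s"
  proof -
    have "continuous_on {s0/2..s0} g" unfolding g_def using s0 by (intro continuous_intros) auto
    then obtain t where t: "t \<in> {s0/2..s0}" "\<And>s. s \<in> {s0/2..s0} \<Longrightarrow> g t \<le> g s"
      using continuous_attains_inf[of "{s0/2..s0}" g] s0 by auto
    moreover have "g t > 0" using t(1) s0 by (auto simp: g_def)
    ultimately show ?thesis using that by blast
  qed
  define Q where "Q v N s = (\<Sum>j<N. \<Sum>k<N. v j * v k * exp (- (dist (x j) (x k))\<^sup>2 / (4 * s)))"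
    for v :: "nat \<Rightarrow> real" and N :: nat and s
  have Q0: "Q v N s \<ge> 0" if "s > 0" for v N s
    unfolding Q_def by (rule gaussian_positive_semidefinite[OF that])
  have Q1: "(\<Sum>j<N. (v j)\<^sup>2) / 2 \<le> Q v N s" if s: "0 < s" "s \<le> s0" for v N s
  proof -
    have "(1 - 1 / 2) * (\<Sum>j<N. (v j)\<^sup>2) \<le> Q v N s"
      unfolding Q_def
    proof (rule quadratic_form_diagonally_dominant)
      fix j
      have "(\<Sum>k\<in>{..<N} - {j}. exp (- (dist (x j) (x k))\<^sup>2 / (4 * s))) \<le> K * s powr (real d / 2)"
        unfolding K_def using sep \<open>1 < 5 ^ d\<close> s
        by (intro gaussian_sum_le \<delta> separated_ball_count[OF \<delta> sep d]) auto
      then show "(\<Sum>k\<in>{..<N} - {j}. exp (- (dist (x j) (x k))\<^sup>2 / (4 * s))) \<le> 1 / 2"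
        using small[OF s] by linarith
    qed (auto simp: dist_commute)
    then show ?thesis by simp
  qed
  \<comment> \<open>Interval length s0 / 2, times the kernel minimum \<open>m\<close>, times 1/2
    from diagonal dominance, over Gamma \<alpha>. Neither \<open>N\<close> nor \<open>v\<close>
    enters.\<close>
  define c where "c = m * s0 / (4 * Gamma \<alpha>)"
  show ?thesis
  proof (rule that)
    show "c > 0" using m s0 G by (simp add: c_def)
    fix N and v :: "nat \<Rightarrow> real"
    define V where "V = (\<Sum>j<N. (v j)\<^sup>2)"
    have V: "V \<ge> 0" by (simp add: V_def sum_nonneg)
    have "((\<lambda>s. \<Sum>j<N. \<Sum>k<N. v j * v k * (s powr (\<alpha> - 1) / exp s * exp (- (dist (x j) (x k))\<^sup>2 / (4 * s))))
        has_integral (\<Sum>j<N. \<Sum>k<N. v j * v k * (matern \<alpha> (dist (x j) (x k)) * Gamma \<alpha>))) {0<..}"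
      by (intro has_integral_sum has_integral_mult_right matern_has_integral \<alpha>) auto
    moreover have "(\<Sum>j<N. \<Sum>k<N. v j * v k * (s powr (\<alpha> - 1) / exp s * exp (- (dist (x j) (x k))\<^sup>2 / (4 * s)))) = g s * Q v N s" for s
      unfolding Q_def g_def sum_distrib_left by (intro sum.cong refl) (simp only: mult_ac)
    moreover have "(\<Sum>j<N. \<Sum>k<N. v j * v k * (matern \<alpha> (dist (x j) (x k)) * Gamma \<alpha>))
        = Gamma \<alpha> * (\<Sum>j<N. \<Sum>k<N. v j * v k * matern \<alpha> (dist (x j) (x k)))"
      unfolding sum_distrib_left by (intro sum.cong refl) (simp only: mult_ac)
    ultimately have 1: "((\<lambda>s. g s * Q v N s) has_integral
        Gamma \<alpha> * (\<Sum>j<N. \<Sum>k<N. v j * v k * matern \<alpha> (dist (x j) (x k)))) {0<..}"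
      by simp
    have 2: "((\<lambda>s. if s \<in> {s0/2..s0} then m * (V / 2) else 0) has_integral (s0 - s0 / 2) *\<^sub>R (m * (V / 2))) {0<..}"
      using s0 has_integral_const_real[of "m * (V / 2)" "s0 / 2" s0]
      by (subst has_integral_restrict) auto
    have 3: "(if s \<in> {s0/2..s0} then m * (V / 2) else 0) \<le> g s * Q v N s" if s: "s \<in> {0<..}" for s
    proof (cases "s \<in> {s0/2..s0}")
      case True
      then have "m * (V / 2) \<le> g s * Q v N s"
        using m V s g0 Q1[of s v N] by (intro mult_mono) (auto simp: V_def)
      with True show ?thesis by simp
    next
      case False
      have "0 \<le> g s * Q v N s" using Q0[of s v N] g0[of s] s by simp
      with False show ?thesis by (simp only: if_False)
    qed
    have "(s0 - s0 / 2) *\<^sub>R (m * (V / 2)) \<le> Gamma \<alpha> * (\<Sum>j<N. \<Sum>k<N. v j * v k * matern \<alpha> (dist (x j) (x k)))"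
      by (rule has_integral_le[OF 2 1 3])
    then have "c * Gamma \<alpha> * V \<le> Gamma \<alpha> * (\<Sum>j<N. \<Sum>k<N. v j * v k * matern \<alpha> (dist (x j) (x k)))"
      using G by (simp add: c_def field_simps)
    then show "c * V \<le> (\<Sum>j<N. \<Sum>k<N. v j * v k * matern \<alpha> (dist (x j) (x k)))"
      using G by (simp add: mult.commute[of c] mult.assoc)
  qed
qed

text \<open>The real part of the form at a complex \<open>v\<close> is the sum of the real forms at
  Re v and Im v, the mixed terms being imaginary. As \<open>c\<close> is the same for every section,
  the bound survives the limit.\<close>

lemma schur_coercive:
  fixes A :: "nat \<Rightarrow> nat \<Rightarrow> real"
  assumes nn: "\<And>j k. A j k \<ge> 0" and sym: "\<And>j k. A j k = A k j"
    and row: "\<And>j N. (\<Sum>k<N. A j k) \<le> R"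
    and form: "\<And>N w. c * (\<Sum>j<N. (w j)\<^sup>2) \<le> (\<Sum>j<N. \<Sum>k<N. w j * w k * A j k)"
    and v: "v \<in> l2"
  shows "c * (l2norm v)\<^sup>2 \<le> Re (l2inner (mat_apply A v) v)"
proof (rule LIMSEQ_le)
  have "(\<lambda>N. \<Sum>j<N. (cmod (v j))\<^sup>2) \<longlonglongrightarrow> (l2norm v)\<^sup>2"
    using v by (auto simp: l2norm_power2 l2_def intro!: summable_LIMSEQ)
  then show "(\<lambda>N. c * (\<Sum>j<N. (cmod (v j))\<^sup>2)) \<longlonglongrightarrow> c * (l2norm v)\<^sup>2" by (rule tendsto_mult_left)
  show "(\<lambda>N. Re (\<Sum>j<N. \<Sum>k<N. complex_of_real (A j k) * v k * cnj (v j))) \<longlonglongrightarrow> Re (l2inner (mat_apply A v) v)"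
    by (intro tendsto_Re schur_form_LIMSEQ[OF nn sym row] v)
  have "c * (\<Sum>j<N. (cmod (v j))\<^sup>2) \<le> Re (\<Sum>j<N. \<Sum>k<N. complex_of_real (A j k) * v k * cnj (v j))" for N
  proof -
    have "c * (\<Sum>j<N. (cmod (v j))\<^sup>2) = c * (\<Sum>j<N. (Re (v j))\<^sup>2) + c * (\<Sum>j<N. (Im (v j))\<^sup>2)"
      by (simp add: cmod_power2 sum.distrib distrib_left)
    also have "\<dots> \<le> (\<Sum>j<N. \<Sum>k<N. Re (v j) * Re (v k) * A j k) + (\<Sum>j<N. \<Sum>k<N. Im (v j) * Im (v k) * A j k)"
      by (intro add_mono form)
    also have "\<dots> = Re (\<Sum>j<N. \<Sum>k<N. complex_of_real (A j k) * v k * cnj (v j))"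
      by (simp add: algebra_simps flip: sum.distrib)
    finally show ?thesis .
  qed
  then show "\<exists>M. \<forall>N\<ge>M. c * (\<Sum>j<N. (cmod (v j))\<^sup>2) \<le> Re (\<Sum>j<N. \<Sum>k<N. complex_of_real (A j k) * v k * cnj (v j))"
    by blast
qed

theorem theorem5p2:
  fixes x :: "nat \<Rightarrow> real ^ 'n" and \<alpha> :: real and d :: nat
  assumes distinct: "inj x"
    and sep: "separation x > 0"
    and dim: "dim (span (range x)) = d"
    and d_range: "1 \<le> d" "d \<le> CARD('n)"
    and alpha: "\<alpha> > 0"
  shows "bounded_matrix_op (schoenberg_matrix x (matern \<alpha>))
           (1 + real d * 2 ^ (d - 1) * (5 ^ d - 1) * Gamma (\<alpha> + real d / 2) * Gamma (real d / 2)
              / (separation x ^ d * Gamma \<alpha>))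
       \<and> defines_selfadjoint_op (schoenberg_matrix x (matern \<alpha>))
       \<and> (CARD('n) \<ge> 2 \<longrightarrow> defines_invertible_op (schoenberg_matrix x (matern \<alpha>)))
       \<and> (CARD('n) = 1 \<and> d = 1 \<and>
            separation x > 4 * Gamma (\<alpha> + 1 / 2) * Gamma (1 / 2) / Gamma \<alpha>
          \<longrightarrow> defines_invertible_op (schoenberg_matrix x (matern \<alpha>)))"
proof -
  define A where "A = schoenberg_matrix x (matern \<alpha>)"
  define R where "R = 1 + real d * 2 ^ (d - 1) * (5 ^ d - 1) * Gamma (\<alpha> + real d / 2) * Gamma (real d / 2)
    / (separation x ^ d * Gamma \<alpha>)"
  have A: "A j k = matern \<alpha> (dist (x j) (x k))" for j k by (simp add: A_def schoenberg_matrix_def)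
  have far: "separation x \<le> dist (x j) (x k)" if "j \<noteq> k" for j k
    unfolding separation_def using that by (intro cInf_lower bdd_belowI[of _ 0]) auto
  have nn: "A j k \<ge> 0" and sym: "A j k = A k j" for j k
    by (simp_all add: A matern_nonneg alpha dist_commute)
  have row: "(\<Sum>k<N. A j k) \<le> R" for j N
    unfolding A R_def by (rule matern_row_sum_le[OF alpha sep far dim d_range(1)])
  obtain c where c: "c > 0" "\<And>N v. c * (\<Sum>j<N. (v j)\<^sup>2) \<le> (\<Sum>j<N. \<Sum>k<N. v j * v k * matern \<alpha> (dist (x j) (x k)))"
    by (rule matern_coercive[OF alpha sep _ dim d_range(1)]) (erule far, rule that)
  have bounded: "bounded_matrix_op A R" by (rule schur_test[OF nn sym row])
  have "defines_selfadjoint_op A" by (rule schur_selfadjoint[OF nn sym row])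
  moreover have "defines_invertible_op A"
    by (rule coercive_invertible[OF bounded c(1) schur_coercive[OF nn sym row c(2)[folded A]]])
  ultimately show ?thesis using bounded unfolding A_def R_def by blast
qed

end
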